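(* Fix $0<\delta\le1/2$ and let $D=(d_1,\ldots,d_n)$ be a $\delta$-tame degree sequence. Let $$\mathcal{U}=\Big\{(\tau_1,\ldots,\tau_n):|\tau_j|\le\tfrac{\ln n}{\sqrt n}\ \text{for } j=1,\ldots,n\Big\},$$ $$\mathcal{W}=\Big\{(\tau_1,\ldots,\tau_n):|\tau_j-\sigma_j\pi|\le\tfrac{\ln n}{\sqrt n}\ \text{for some }\sigma_j=\pm1,\ \text{for all } j=1,\ldots,n\Big\}.$$ Then for any $\kappa>0$, $$\int_{\Pi\setminus(\mathcal{U}\cup\mathcal{W})}|F(t)|\,dt\le n^{-\kappa}\int_{\mathcal{U}}|F(t)|\,dt$$ provided $n>\gamma(\delta,\kappa)$, for some constant $\gamma(\delta,\kappa)>0$.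
   Context: $\Pi=[-\pi,\pi]^n$. Coordinates of $\mathbb{R}^{\binom n2}$ are indexed by unordered pairs $\{j,k\}$, $1\le j\ne k\le n$. $\mathcal{P}(D)$ is the polytope of $x=(\xi_{\{j,k\}})$ with $\sum_{j:\,j\ne k}\xi_{\{j,k\}}=d_k$ and $0\le\xi_{\{j,k\}}\le1$; $H(x)=\sum_{\{j,k\}}\big(\xi_{\{j,k\}}\ln\frac1{\xi_{\{j,k\}}}+(1-\xi_{\{j,k\}})\ln\frac1{1-\xi_{\{j,k\}}}\big)$, with unique maximizer $z=(\zeta_{\{j,k\}})$ on $\mathcal{P}(D)$ (maximum entropy matrix). $D$ is $\delta$-tame if $\mathcal{P}(D)\ne\emptyset$ and $\delta\le\zeta_{\{j,k\}}\le1-\delta$ for all $j\ne k$. $F(t)=\exp\{-i\sum_{m=1}^nd_m\tau_m\}\prod_{\{j,k\}}(1-\zeta_{\{j,k\}}+\zeta_{\{j,k\}}e^{i(\tau_j+\tau_k)})$ for $t=(\tau_1,\ldots,\tau_n)$. *)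

theory Defs
  imports "HOL-Analysis.Analysis"
begin

definition pairs :: "nat \<Rightarrow> nat set set" where
  "pairs n = {{j, k} | j k. j \<in> {1..n} \<and> k \<in> {1..n} \<and> j \<noteq> k}"

text \<open>A point of the Euclidean space with one coordinate per unordered pair is an extensional
  function on \<^term>\<open>pairs n\<close>, so distinct functions are distinct points.\<close>

definition degree_polytope :: "nat \<Rightarrow> (nat \<Rightarrow> nat) \<Rightarrow> (nat set \<Rightarrow> real) set" where
  "degree_polytope n d =
     {x \<in> pairs n \<rightarrow>\<^sub>E {0..1}. \<forall>k\<in>{1..n}. (\<Sum>j\<in>{1..n} - {k}. x {j, k}) = real (d k)}"

text \<open>The convention \<open>0 ln (1/0) = 0\<close> is respected, since the product has a factor \<open>0\<close>.\<close>

definition entropy :: "nat \<Rightarrow> (nat set \<Rightarrow> real) \<Rightarrow> real" where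
  "entropy n x = (\<Sum>e\<in>pairs n. x e * ln (1 / x e) + (1 - x e) * ln (1 / (1 - x e)))"

text \<open>If the polytope is nonempty, the maximizer exists by compactness and is unique by strict
  concavity of the entropy; otherwise the value is unspecified.\<close>

definition max_entropy_matrix :: "nat \<Rightarrow> (nat \<Rightarrow> nat) \<Rightarrow> (nat set \<Rightarrow> real)" where
  "max_entropy_matrix n d = arg_max (entropy n) (\<lambda>x. x \<in> degree_polytope n d)"

definition tame :: "real \<Rightarrow> nat \<Rightarrow> (nat \<Rightarrow> nat) \<Rightarrow> bool" where
  "tame \<delta> n d \<longleftrightarrow> degree_polytope n d \<noteq> {} \<and>
     (\<forall>e\<in>pairs n. \<delta> \<le> max_entropy_matrix n d e \<and> max_entropy_matrix n d e \<le> 1 - \<delta>)"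

text \<open>For \<open>e = {j, k}\<close> in \<^term>\<open>pairs n\<close> the inner sum is \<open>\<tau>\<^sub>j + \<tau>\<^sub>k\<close>.\<close>

definition F :: "nat \<Rightarrow> (nat \<Rightarrow> nat) \<Rightarrow> (nat \<Rightarrow> real) \<Rightarrow> complex" where
  "F n d t = exp (- (\<i> * of_real (\<Sum>m = 1..n. real (d m) * t m))) *
     (\<Prod>e\<in>pairs n. 1 - of_real (max_entropy_matrix n d e) +
        of_real (max_entropy_matrix n d e) * exp (\<i> * of_real (\<Sum>j\<in>e. t j)))"

text \<open>The dimension has to vary within the theorem, so \<open>n\<close>-dimensional space consists of the
  extensional functions on \<open>{1..n}\<close>, with Lebesgue measure as a product measure.\<close>

definition lebesgue_space :: "nat \<Rightarrow> (nat \<Rightarrow> real) measure" where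
  "lebesgue_space n = Pi\<^sub>M {1..n} (\<lambda>_. lborel)"

definition cube :: "nat \<Rightarrow> (nat \<Rightarrow> real) set" where
  "cube n = {1..n} \<rightarrow>\<^sub>E {-pi..pi}"

definition U_region :: "nat \<Rightarrow> (nat \<Rightarrow> real) set" where
  "U_region n = {t \<in> {1..n} \<rightarrow>\<^sub>E UNIV. \<forall>j\<in>{1..n}. \<bar>t j\<bar> \<le> ln (real n) / sqrt (real n)}"

definition W_region :: "nat \<Rightarrow> (nat \<Rightarrow> real) set" where
  "W_region n = {t \<in> {1..n} \<rightarrow>\<^sub>E UNIV. \<forall>j\<in>{1..n}. \<exists>\<sigma>\<in>{-1, 1}.
     \<bar>t j - \<sigma> * pi\<bar> \<le> ln (real n) / sqrt (real n)}"

end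

theory Submission
  imports Defs "HOL-Real_Asymp.Real_Asymp"
begin

text \<open>The modulus of \<open>F\<close> is a product over the edges of factors that are at most
  \<open>exp (- \<delta> / 2 * (1 - cos \<theta>))\<close> and, for small \<open>\<theta>\<close>, at least \<open>exp (- (1 - cos \<theta>) / 2)\<close>, where
  \<open>\<theta> = \<tau>\<^sub>j + \<tau>\<^sub>k\<close>. With \<open>X = \<Sum>\<^sub>j cos \<tau>\<^sub>j\<close> the sum of \<open>1 - cos \<theta>\<close> over the edges is at least
  \<open>(n\<^sup>2 - X\<^sup>2) / 2 - n\<close>. Hence either it exceeds a multiple of \<open>n ln n\<close>, and \<open>F\<close> is negligible even
  against a box of side \<open>2 / sqrt n\<close>, or \<open>n - \<bar>X\<bar> \<le> L\<close> with \<open>L = O(ln n)\<close>. Turning every coordinate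
  by \<open>\<pi>\<close> preserves the modulus of \<open>F\<close>, so assume \<open>X \<ge> 0\<close>. If \<open>A \<noteq> {}\<close> is the set of coordinates
  larger than \<open>ln n / sqrt n\<close>, then pulling these into \<open>[-1 / sqrt n, 1 / sqrt n]\<close> while the others
  stay fixed gains a factor \<open>exp (c ln\<^sup>2 n - O(ln n))\<close> for each element of \<open>A\<close>, because the other
  coordinates have total defect at most \<open>L\<close>. This outweighs the loss of volume and the number of
  choices of \<open>A\<close>.\<close>

subsection \<open>The edge factors\<close>

text \<open>For \<open>z\<close> in [0, 1] this is the modulus at \<open>\<theta>\<close> of the
  characteristic function of a Bernoulli variable with mean \<open>z\<close>. It sees the angle only
  through \<open>cos \<theta>\<close>, which is what makes half turns of all coordinates harmless
  later.\<close>

definition factor :: "real \<Rightarrow> real \<Rightarrow> real" where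
  "factor z \<theta> = sqrt (1 - 2 * z * (1 - z) * (1 - cos \<theta>))"

lemma cmod_characteristic_factor:
  "cmod (1 - of_real z + of_real z * exp (\<i> * of_real \<theta>)) = factor z \<theta>"
proof -
  have "(1 - z + z * cos \<theta>)\<^sup>2 + (z * sin \<theta>)\<^sup>2 = 1 - 2 * z * (1 - z) * (1 - cos \<theta>)"
    using sin_cos_squared_add[of \<theta>] by algebra
  then show ?thesis
    by (simp add: cmod_def factor_def cos_of_real sin_of_real Re_exp Im_exp)
qed

lemma factor_nonneg: "0 \<le> z \<Longrightarrow> z \<le> 1 \<Longrightarrow> 0 \<le> factor z \<theta>"
  by (metis cmod_characteristic_factor norm_ge_zero)

text \<open>On [\<delta>, 1 - \<delta>] the concave function \<open>2 * z * (1 - z)\<close> is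
  smallest at the ends, where it equals 2\<delta>(1 - \<delta>) \<ge> \<delta>. Then 1 - x \<le>
  exp(-x) bounds the square, and the root halves the exponent.\<close>

lemma factor_le:
  assumes "0 < \<delta>" "\<delta> \<le> z" "z \<le> 1 - \<delta>"
  shows "factor z \<theta> \<le> exp (- (\<delta> / 2 * (1 - cos \<theta>)))"
proof -
  have "0 \<le> (z - \<delta>) * (1 - \<delta> - z)" using assms by simp
  moreover have "0 \<le> \<delta> * (1 - 2 * \<delta>)" using assms by simp
  ultimately have "\<delta> \<le> 2 * z * (1 - z)" by (simp add: algebra_simps)
  then have "\<delta> * (1 - cos \<theta>) \<le> 2 * z * (1 - z) * (1 - cos \<theta>)"
    by (intro mult_right_mono) auto
  then have "1 - 2 * z * (1 - z) * (1 - cos \<theta>) \<le> 1 + (- (\<delta> * (1 - cos \<theta>)))" by simp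
  also have "\<dots> \<le> exp (- (\<delta> * (1 - cos \<theta>)))" by (rule exp_ge_add_one_self)
  also have "\<dots> = (exp (- (\<delta> / 2 * (1 - cos \<theta>))))\<^sup>2"
    by (simp add: power2_eq_square flip: exp_add)
  finally show ?thesis unfolding factor_def by (intro real_le_lsqrt) auto
qed

text \<open>Since 2z(1 - z) \<le> 1/2 for every real \<open>z\<close>, the square of the factor is
  at least 1 - y with y = (1 - cos \<theta>)/2. A nonnegative cosine gives y \<le> 1/2, the range in
  which ln(1 - y) \<ge> -y - 2y^2 \<ge> -2y.\<close>

lemma factor_ge:
  assumes "0 \<le> cos \<theta>"
  shows "exp (- ((1 - cos \<theta>) / 2)) \<le> factor z \<theta>"
proof -
  define y where "y = (1 - cos \<theta>) / 2"
  have y: "0 \<le> y" "y \<le> 1 / 2" using assms by (auto simp: y_def)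
  have "0 \<le> (1 - 2 * z)\<^sup>2" by simp
  then have "2 * z * (1 - z) \<le> 1 / 2" by (simp add: power2_eq_square algebra_simps)
  then have "2 * z * (1 - z) * (1 - cos \<theta>) \<le> 1 / 2 * (1 - cos \<theta>)"
    by (intro mult_right_mono) auto
  then have *: "1 - y \<le> 1 - 2 * z * (1 - z) * (1 - cos \<theta>)" by (simp add: y_def)
  have "2 * y * y \<le> 1 * y" using y by (intro mult_right_mono) auto
  then have "- (2 * y) \<le> ln (1 - y)"
    using ln_one_minus_pos_lower_bound[of y] y by (simp add: power2_eq_square)
  then have "exp (- (2 * y)) \<le> 1 - y" using y by (simp add: ln_ge_iff)
  moreover have "exp (- (2 * y)) = (exp (- y))\<^sup>2" by (simp add: power2_eq_square flip: exp_add)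
  ultimately have "(exp (- y))\<^sup>2 \<le> 1 - 2 * z * (1 - z) * (1 - cos \<theta>)" using * by simp
  then show ?thesis unfolding factor_def y_def[symmetric] by (rule real_le_rsqrt)
qed

section \<open>Trigonometric inequalities for 1 - cos\<close>

lemma one_minus_cos_eq: "1 - cos x = 2 * (sin (x / 2))\<^sup>2" for x :: real
  using cos_double_sin[of "x / 2"] by simp

text \<open>By the half-angle formula this is the subadditivity of |sin| followed by (a + b)^2 \<le>
  2a^2 + 2b^2.\<close>

lemma one_minus_cos_add_le: "1 - cos (x + y) \<le> 2 * (1 - cos x) + 2 * (1 - cos y)" for x y :: real
proof -
  have "\<bar>sin (x / 2 + y / 2)\<bar> \<le> \<bar>sin (x / 2)\<bar> * \<bar>cos (y / 2)\<bar> + \<bar>cos (x / 2)\<bar> * \<bar>sin (y / 2)\<bar>"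
    unfolding sin_add abs_mult[symmetric] by (rule abs_triangle_ineq)
  also have "\<dots> \<le> \<bar>sin (x / 2)\<bar> * 1 + 1 * \<bar>sin (y / 2)\<bar>"
    by (intro add_mono mult_mono) auto
  finally have "\<bar>sin ((x + y) / 2)\<bar> \<le> \<bar>sin (x / 2)\<bar> + \<bar>sin (y / 2)\<bar>"
    by (simp add: add_divide_distrib)
  then have "\<bar>sin ((x + y) / 2)\<bar>\<^sup>2 \<le> (\<bar>sin (x / 2)\<bar> + \<bar>sin (y / 2)\<bar>)\<^sup>2"
    by (rule power_mono) simp
  also have "\<dots> \<le> 2 * \<bar>sin (x / 2)\<bar>\<^sup>2 + 2 * \<bar>sin (y / 2)\<bar>\<^sup>2"
    using sum_squares_bound[of "\<bar>sin (x / 2)\<bar>" "\<bar>sin (y / 2)\<bar>"]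
    by (simp add: power2_sum)
  finally show ?thesis unfolding one_minus_cos_eq by simp
qed

lemma one_minus_cos_le_add: "1 - cos x \<le> 2 * (1 - cos (x + y)) + 2 * (1 - cos y)" for x y :: real
  using one_minus_cos_add_le[of "x + y" "- y"] by simp

lemma one_minus_cos_le_square: "1 - cos x \<le> x\<^sup>2 / 2" for x :: real
proof -
  have "\<bar>sin (x / 2)\<bar>\<^sup>2 \<le> \<bar>x / 2\<bar>\<^sup>2" by (intro power_mono abs_sin_x_le_abs_x) auto
  then show ?thesis unfolding one_minus_cos_eq by (simp add: power2_eq_square)
qed


text \<open>With u = |x|/4 \<le> \<pi>/4 one has sin(2u) = 2 tan(u) cos(u)^2 \<ge> u, because tan u
  \<ge> u and cos(u)^2 \<ge> 1/2. Hence 1 - cos x = 2 sin(2u)^2 \<ge> 2u^2 = x^2/8.\<close>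

lemma one_minus_cos_ge_square:
  fixes x :: real
  assumes "\<bar>x\<bar> \<le> pi"
  shows "x\<^sup>2 / 8 \<le> 1 - cos x"
proof -
  define u where "u = \<bar>x\<bar> / 4"
  have u: "0 \<le> u" "u \<le> pi / 4" using assms by (auto simp: u_def)
  have "u \<le> tan u"
  proof -
    have "tan 0 - 0 \<le> tan u - u"
    proof (rule DERIV_nonneg_imp_nondecreasing[OF u(1)])
      fix y assume y: "0 \<le> y" "y \<le> u"
      then have "0 < cos y" using u pi_gt_zero by (intro cos_gt_zero_pi) linarith+
      then have "((\<lambda>y. tan y - y) has_real_derivative inverse ((cos y)\<^sup>2) - 1) (at y)"
        by (auto intro!: derivative_eq_intros)
      moreover have "(cos y)\<^sup>2 \<le> 1" by (simp add: abs_square_le_1)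
      then have "0 \<le> inverse ((cos y)\<^sup>2) - 1" using \<open>0 < cos y\<close> by (simp add: one_le_inverse)
      ultimately show "\<exists>y'. ((\<lambda>y. tan y - y) has_real_derivative y') (at y) \<and> 0 \<le> y'" by blast
    qed
    then show ?thesis by simp
  qed
  have "cos (pi / 4) \<le> cos u" using u by (intro cos_monotone_0_pi_le) auto
  then have "(cos (pi / 4))\<^sup>2 \<le> (cos u)\<^sup>2" by (intro power_mono) (auto simp: cos_45)
  moreover have "0 < cos u" using u pi_gt_zero by (intro cos_gt_zero_pi) linarith+
  ultimately have c: "1 / 2 \<le> (cos u)\<^sup>2" "0 < cos u"
    by (auto simp: cos_45 power_divide)
  have "u * (1 / 2) \<le> tan u * (cos u)\<^sup>2"
    using \<open>u \<le> tan u\<close> c u by (intro mult_mono) auto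
  also have "\<dots> = sin u * cos u" using c by (simp add: tan_def power2_eq_square)
  finally have "u \<le> sin (2 * u)" by (simp add: sin_double)
  then have "u\<^sup>2 \<le> (sin (2 * u))\<^sup>2" using u by (intro power_mono) auto
  moreover have "(sin (2 * u))\<^sup>2 = (sin (x / 2))\<^sup>2" by (simp add: u_def abs_if)
  ultimately show ?thesis unfolding one_minus_cos_eq by (simp add: u_def power2_eq_square)
qed

subsection \<open>Sums over edges\<close>

lemma finite_pairs [simp]: "finite (pairs n)"
proof -
  have "pairs n \<subseteq> Pow {1..n}" by (auto simp: pairs_def)
  then show ?thesis by (rule finite_subset) simp
qed

lemma card_pairs: "e \<in> pairs n \<Longrightarrow> card e = 2"
  by (auto simp: pairs_def)

lemma pairs_subset: "e \<in> pairs n \<Longrightarrow> e \<subseteq> {1..n}"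
  by (auto simp: pairs_def)

lemma doubleton_in_pairs: "j \<in> {1..n} \<Longrightarrow> k \<in> {1..n} \<Longrightarrow> j \<noteq> k \<Longrightarrow> {j, k} \<in> pairs n"
  unfolding pairs_def by blast

lemma sum_incident_pairs:
  fixes h :: "nat set \<Rightarrow> real"
  assumes "j \<in> {1..n}"
  shows "(\<Sum>k\<in>{1..n} - {j}. h {j, k}) = (\<Sum>e | e \<in> pairs n \<and> j \<in> e. h e)"
proof -
  have "{e. e \<in> pairs n \<and> j \<in> e} = (\<lambda>k. {j, k}) ` ({1..n} - {j})"
    using assms by (auto simp: pairs_def image_iff doubleton_eq_iff) (metis insert_commute)+
  moreover have "inj_on (\<lambda>k. {j, k}) ({1..n} - {j})"
    by (auto simp: inj_on_def doubleton_eq_iff)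
  ultimately show ?thesis by (simp add: sum.reindex)
qed

text \<open>Double counting: an edge appears on the left once for each of its endpoints in
  \<open>A\<close>.\<close>

lemma sum_incidences:
  fixes h :: "nat set \<Rightarrow> real"
  assumes "A \<subseteq> {1..n}"
  shows "(\<Sum>j\<in>A. \<Sum>k\<in>{1..n} - {j}. h {j, k}) = (\<Sum>e\<in>pairs n. real (card (A \<inter> e)) * h e)"
proof -
  have fin: "finite A" using assms finite_subset by blast
  have "(\<Sum>j\<in>A. \<Sum>k\<in>{1..n} - {j}. h {j, k}) = (\<Sum>j\<in>A. \<Sum>e | e \<in> pairs n \<and> j \<in> e. h e)"
    using assms by (intro sum.cong sum_incident_pairs) auto
  also have "\<dots> = (\<Sum>e\<in>pairs n. \<Sum>j | j \<in> A \<and> j \<in> e. h e)"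
    using fin by (intro sum.swap_restrict) auto
  also have "\<dots> = (\<Sum>e\<in>pairs n. real (card (A \<inter> e)) * h e)"
    by (simp add: Int_def)
  finally show ?thesis .
qed

lemma sum_ordered_pairs:
  fixes h :: "nat set \<Rightarrow> real"
  shows "(\<Sum>j\<in>{1..n}. \<Sum>k\<in>{1..n} - {j}. h {j, k}) = 2 * (\<Sum>e\<in>pairs n. h e)"
proof -
  have "(\<Sum>e\<in>pairs n. real (card ({1..n} \<inter> e)) * h e) = (\<Sum>e\<in>pairs n. 2 * h e)"
    by (intro sum.cong refl) (simp add: Int_absorb1 pairs_subset card_pairs del: One_nat_def)
  then show ?thesis by (simp add: sum_incidences sum_distrib_left del: One_nat_def)
qed

text \<open>The index set on the left consists of the edges that meet \<open>A\<close>; each of them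
  is counted at least once in the incidence sum.\<close>

lemma sum_meeting_pairs_le:
  fixes h :: "nat set \<Rightarrow> real"
  assumes "A \<subseteq> {1..n}" and "\<And>e. e \<in> pairs n \<Longrightarrow> 0 \<le> h e"
  shows "(\<Sum>e | e \<in> pairs n \<and> \<not> e \<subseteq> {1..n} - A. h e) \<le> (\<Sum>j\<in>A. \<Sum>k\<in>{1..n} - {j}. h {j, k})"
proof -
  have fin: "finite A" using assms(1) finite_subset by blast
  have "(\<Sum>e | e \<in> pairs n \<and> \<not> e \<subseteq> {1..n} - A. h e)
      \<le> (\<Sum>e | e \<in> pairs n \<and> \<not> e \<subseteq> {1..n} - A. real (card (A \<inter> e)) * h e)"
  proof (rule sum_mono)
    fix e assume e: "e \<in> {e. e \<in> pairs n \<and> \<not> e \<subseteq> {1..n} - A}"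
    then have "A \<inter> e \<noteq> {}" using pairs_subset by blast
    then have "1 \<le> card (A \<inter> e)" using fin by (simp add: Suc_le_eq card_gt_0_iff)
    then have "1 * h e \<le> real (card (A \<inter> e)) * h e"
      using assms(2) e by (intro mult_right_mono) auto
    then show "h e \<le> real (card (A \<inter> e)) * h e" by simp
  qed
  also have "\<dots> \<le> (\<Sum>e\<in>pairs n. real (card (A \<inter> e)) * h e)"
    using assms(2) by (intro sum_mono2) auto
  finally show ?thesis unfolding sum_incidences[OF assms(1)] .
qed

text \<open>Pairs in \<open>A\<close> times its complement give distinct edges, and all of these
  meet \<open>A\<close>; the edges inside \<open>A\<close> are dropped.\<close>

lemma sum_crossing_pairs_le:
  fixes h :: "nat set \<Rightarrow> real"
  assumes "A \<subseteq> {1..n}" and "\<And>e. e \<in> pairs n \<Longrightarrow> 0 \<le> h e"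
  shows "(\<Sum>j\<in>A. \<Sum>k\<in>{1..n} - A. h {j, k}) \<le> (\<Sum>e | e \<in> pairs n \<and> \<not> e \<subseteq> {1..n} - A. h e)"
proof -
  have inj: "inj_on (\<lambda>(j, k). {j, k}) (A \<times> ({1..n} - A))"
    by (auto simp: inj_on_def doubleton_eq_iff)
  have "(\<Sum>j\<in>A. \<Sum>k\<in>{1..n} - A. h {j, k}) = (\<Sum>e\<in>(\<lambda>(j, k). {j, k}) ` (A \<times> ({1..n} - A)). h e)"
    unfolding sum.reindex[OF inj] sum.cartesian_product by (simp add: case_prod_unfold)
  also have "\<dots> \<le> (\<Sum>e | e \<in> pairs n \<and> \<not> e \<subseteq> {1..n} - A. h e)"
  proof (rule sum_mono2)
    show "(\<lambda>(j, k). {j, k}) ` (A \<times> ({1..n} - A)) \<subseteq> {e. e \<in> pairs n \<and> \<not> e \<subseteq> {1..n} - A}"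
      using assms(1) by (auto intro!: doubleton_in_pairs)
  qed (use assms(2) in auto)
  finally show ?thesis .
qed

section \<open>Edge defects and the sum of the cosines\<close>

definition defect :: "(nat \<Rightarrow> real) \<Rightarrow> nat set \<Rightarrow> real" where
  "defect t e = 1 - cos (\<Sum>j\<in>e. t j)"

lemma defect_nonneg [simp]: "0 \<le> defect t e"
  by (simp add: defect_def)

lemma defect_doubleton: "j \<noteq> k \<Longrightarrow> defect t {j, k} = 1 - cos (t j + t k)"
  by (simp add: defect_def)

text \<open>Expanding cos(a + b) over all ordered pairs, the diagonal included, gives the squared
  cosine sum minus the squared sine sum; the latter is discarded. Each of the n diagonal terms is at
  most 2, and every edge arises from two ordered pairs.\<close>

lemma cos_sum_square_ge:
  "(real n)\<^sup>2 - (\<Sum>j\<in>{1..n}. cos (t j))\<^sup>2 \<le> 2 * (\<Sum>e\<in>pairs n. defect t e) + 2 * real n"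
proof -
  let ?I = "{1..n}"
  have "(\<Sum>j\<in>?I. \<Sum>k\<in>?I. 1 - cos (t j + t k))
      = (\<Sum>j\<in>?I. \<Sum>k\<in>?I. 1 - cos (t j) * cos (t k) + sin (t j) * sin (t k))"
    by (simp add: cos_add algebra_simps)
  also have "\<dots> = (real n)\<^sup>2 - (\<Sum>j\<in>?I. cos (t j))\<^sup>2 + (\<Sum>j\<in>?I. sin (t j))\<^sup>2"
    by (simp add: sum.distrib sum_subtractf power2_eq_square sum_product)
  finally have 1: "(real n)\<^sup>2 - (\<Sum>j\<in>?I. cos (t j))\<^sup>2 \<le> (\<Sum>j\<in>?I. \<Sum>k\<in>?I. 1 - cos (t j + t k))"
    by simp
  have "(\<Sum>j\<in>?I. \<Sum>k\<in>?I. 1 - cos (t j + t k))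
      = (\<Sum>j\<in>?I. (1 - cos (t j + t j)) + (\<Sum>k\<in>?I - {j}. 1 - cos (t j + t k)))"
    by (intro sum.cong refl sum.remove) auto
  also have "\<dots> = (\<Sum>j\<in>?I. (1 - cos (t j + t j)) + (\<Sum>k\<in>?I - {j}. defect t {j, k}))"
    by (auto intro!: sum.cong arg_cong2[where f="(+)"] simp: defect_doubleton)
  also have "\<dots> \<le> (\<Sum>j\<in>?I. 2 + (\<Sum>k\<in>?I - {j}. defect t {j, k}))"
  proof (intro sum_mono add_right_mono)
    fix j show "1 - cos (t j + t j) \<le> 2" using cos_ge_minus_one[of "t j + t j"] by linarith
  qed
  also have "\<dots> = 2 * real n + 2 * (\<Sum>e\<in>pairs n. defect t e)"
    by (simp only: sum.distrib sum_ordered_pairs) simp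
  finally show ?thesis using 1 by simp
qed

section \<open>The modulus of F as a product over edges\<close>

definition edge_product :: "(nat set \<Rightarrow> real) \<Rightarrow> nat set set \<Rightarrow> (nat \<Rightarrow> real) \<Rightarrow> real" where
  "edge_product \<zeta> E t = (\<Prod>e\<in>E. factor (\<zeta> e) (\<Sum>j\<in>e. t j))"

lemma edge_product_cong:
  assumes "\<And>e j. e \<in> E \<Longrightarrow> j \<in> e \<Longrightarrow> s j = t j"
  shows "edge_product \<zeta> E s = edge_product \<zeta> E t"
  unfolding edge_product_def
  by (intro prod.cong refl arg_cong[where f="factor _"] sum.cong) (rule assms)

lemma cmod_F: "cmod (F n d t) = edge_product (max_entropy_matrix n d) (pairs n) t"
  unfolding F_def edge_product_def norm_mult prod_norm[symmetric] cmod_characteristic_factor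
  by (simp add: norm_exp_eq_Re)

lemma borel_measurable_coordinate:
  "j \<in> J \<Longrightarrow> (\<lambda>t. t j) \<in> borel_measurable (Pi\<^sub>M J (\<lambda>_. lborel :: real measure))"
  using measurable_component_singleton[of j J "\<lambda>_. lborel :: real measure"] by (simp only: measurable_lborel1)

lemma measurable_edge_product:
  assumes "\<And>e. e \<in> E \<Longrightarrow> e \<subseteq> J"
  shows "edge_product \<zeta> E \<in> borel_measurable (Pi\<^sub>M J (\<lambda>_. lborel))"
proof -
  have "factor z \<in> borel_measurable borel" for z
    unfolding factor_def by measurable
  moreover have "(\<lambda>t. \<Sum>j\<in>e. t j) \<in> borel_measurable (Pi\<^sub>M J (\<lambda>_. lborel))" if "e \<in> E" for e
    using assms[OF that] by (intro borel_measurable_sum borel_measurable_coordinate) auto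
  ultimately have "(\<lambda>t. factor (\<zeta> e) (\<Sum>j\<in>e. t j)) \<in> borel_measurable (Pi\<^sub>M J (\<lambda>_. lborel))"
    if "e \<in> E" for e
    using that measurable_compose by blast
  then show ?thesis unfolding edge_product_def[abs_def] by (intro borel_measurable_prod)
qed

section \<open>Two-sided bounds for products over edges with weights in
  [\<delta>, 1 - \<delta>]\<close>

locale edge_parameters =
  fixes n :: nat and \<zeta> :: "nat set \<Rightarrow> real" and \<delta> :: real
  assumes \<delta>_pos: "0 < \<delta>"
    and \<zeta>_bounds: "\<And>e. e \<in> pairs n \<Longrightarrow> \<delta> \<le> \<zeta> e \<and> \<zeta> e \<le> 1 - \<delta>"
begin

lemma edge_factor_nonneg: "e \<in> pairs n \<Longrightarrow> 0 \<le> factor (\<zeta> e) \<theta>"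
  using \<zeta>_bounds[of e] \<delta>_pos by (intro factor_nonneg) auto

lemma edge_product_nonneg: "E \<subseteq> pairs n \<Longrightarrow> 0 \<le> edge_product \<zeta> E t"
  unfolding edge_product_def by (intro prod_nonneg ballI edge_factor_nonneg) auto

lemma edge_product_le:
  assumes "E \<subseteq> pairs n"
  shows "edge_product \<zeta> E t \<le> exp (- (\<delta> / 2 * (\<Sum>e\<in>E. defect t e)))"
proof -
  have "edge_product \<zeta> E t \<le> (\<Prod>e\<in>E. exp (- (\<delta> / 2 * defect t e)))"
    unfolding edge_product_def defect_def using assms \<delta>_pos \<zeta>_bounds
    by (intro prod_mono conjI edge_factor_nonneg factor_le) auto
  also have "\<dots> = exp (\<Sum>e\<in>E. - (\<delta> / 2 * defect t e))"
    using assms by (intro exp_sum[symmetric]) (auto intro: finite_subset)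
  finally show ?thesis by (simp add: sum_negf sum_distrib_left)
qed

lemma edge_product_ge:
  assumes "E \<subseteq> pairs n" and "\<And>e. e \<in> E \<Longrightarrow> 0 \<le> cos (\<Sum>j\<in>e. t j)"
  shows "exp (- ((\<Sum>e\<in>E. defect t e) / 2)) \<le> edge_product \<zeta> E t"
proof -
  have "exp (- ((\<Sum>e\<in>E. defect t e) / 2)) = exp (\<Sum>e\<in>E. - (defect t e / 2))"
    by (simp add: sum_negf sum_divide_distrib)
  also have "\<dots> = (\<Prod>e\<in>E. exp (- (defect t e / 2)))"
    using assms(1) by (intro exp_sum) (auto intro: finite_subset)
  also have "\<dots> \<le> edge_product \<zeta> E t"
    unfolding edge_product_def defect_def using assms(2)
    by (intro prod_mono conjI factor_ge) auto
  finally show ?thesis .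
qed

lemma edge_product_split:
  "edge_product \<zeta> (pairs n) t =
     edge_product \<zeta> {e \<in> pairs n. e \<subseteq> B} t * edge_product \<zeta> {e \<in> pairs n. \<not> e \<subseteq> B} t"
proof -
  have "pairs n = {e \<in> pairs n. e \<subseteq> B} \<union> {e \<in> pairs n. \<not> e \<subseteq> B}" by blast
  then have "edge_product \<zeta> (pairs n) t =
      edge_product \<zeta> ({e \<in> pairs n. e \<subseteq> B} \<union> {e \<in> pairs n. \<not> e \<subseteq> B}) t"
    by (rule arg_cong)
  also have "\<dots> = edge_product \<zeta> {e \<in> pairs n. e \<subseteq> B} t * edge_product \<zeta> {e \<in> pairs n. \<not> e \<subseteq> B} t"
    unfolding edge_product_def by (intro prod.union_disjoint) auto
  finally show ?thesis .
qed

text \<open>For j in \<open>A\<close> and k outside, the edge {j, k} has defect at least r^2/16 - (1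
  - cos t_k), as 1 - cos t_j \<ge> r^2/8. At least n/2 coordinates lie outside \<open>A\<close>, so
  each j contributes at least n r^2/32 - L. The edges inside the complement of \<open>A\<close> stay
  untouched as a common factor for the later comparison.\<close>

lemma edge_product_le_outlying:
  assumes A: "A \<subseteq> {1..n}" and card: "2 * card A \<le> n"
    and big: "\<And>j. j \<in> A \<Longrightarrow> r \<le> \<bar>t j\<bar> \<and> \<bar>t j\<bar> \<le> pi" and "0 \<le> r"
    and L: "(\<Sum>k\<in>{1..n} - A. 1 - cos (t k)) \<le> L"
  shows "edge_product \<zeta> (pairs n) t \<le>
    exp (- (\<delta> / 2 * (real (card A) * (real n * r\<^sup>2 / 32 - L)))) * edge_product \<zeta> {e \<in> pairs n. e \<subseteq> {1..n} - A} t"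
proof -
  let ?B = "{1..n} - A"
  have fin: "finite A" using A finite_subset by blast
  have cardB: "real n / 2 \<le> real (card ?B)"
    using card A fin by (simp add: card_Diff_subset)
  have row: "real n * r\<^sup>2 / 32 - L \<le> (\<Sum>k\<in>?B. defect t {j, k})" if j: "j \<in> A" for j
  proof -
    have "r\<^sup>2 \<le> \<bar>t j\<bar>\<^sup>2" using big[OF j] \<open>0 \<le> r\<close> by (intro power_mono) auto
    then have "r\<^sup>2 / 8 \<le> 1 - cos (t j)" using one_minus_cos_ge_square[of "t j"] big[OF j] by simp
    have "real n * r\<^sup>2 / 32 - L \<le> real (card ?B) * (r\<^sup>2 / 16) - L"
      using mult_right_mono[OF cardB, of "r\<^sup>2 / 16"] by simp
    also have "\<dots> \<le> (\<Sum>k\<in>?B. r\<^sup>2 / 16) - (\<Sum>k\<in>?B. 1 - cos (t k))" using L by simp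
    also have "\<dots> = (\<Sum>k\<in>?B. r\<^sup>2 / 16 - (1 - cos (t k)))" by (simp add: sum_subtractf)
    also have "\<dots> \<le> (\<Sum>k\<in>?B. defect t {j, k})"
    proof (rule sum_mono)
      fix k assume "k \<in> ?B"
      then have "defect t {j, k} = 1 - cos (t j + t k)" using j by (intro defect_doubleton) auto
      then show "r\<^sup>2 / 16 - (1 - cos (t k)) \<le> defect t {j, k}"
        using one_minus_cos_le_add[of "t j" "t k"] \<open>r\<^sup>2 / 8 \<le> 1 - cos (t j)\<close>
        by (simp add: field_simps)
    qed
    finally show ?thesis .
  qed
  have "real (card A) * (real n * r\<^sup>2 / 32 - L) \<le> (\<Sum>j\<in>A. \<Sum>k\<in>?B. defect t {j, k})"
    using sum_mono[OF row] by simp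
  also have "\<dots> \<le> (\<Sum>e | e \<in> pairs n \<and> \<not> e \<subseteq> ?B. defect t e)"
    by (intro sum_crossing_pairs_le A) simp
  finally have "edge_product \<zeta> {e \<in> pairs n. \<not> e \<subseteq> ?B} t \<le>
      exp (- (\<delta> / 2 * (real (card A) * (real n * r\<^sup>2 / 32 - L))))"
    using \<delta>_pos by (intro order_trans[OF edge_product_le]) auto
  then show ?thesis
    unfolding edge_product_split[of t ?B] mult.commute[of _ "edge_product \<zeta> {e \<in> pairs n. e \<subseteq> ?B} t"]
    by (intro mult_left_mono edge_product_nonneg) auto
qed

text \<open>This is the counterpart of \<open>edge_product_le_outlying\<close> once the coordinates
  in \<open>A\<close> have been pulled to size at most \<open>s\<close>: the edges meeting
  \<open>A\<close> now cost at most a factor exp(-(1 + L)) for each element of \<open>A\<close>. The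
  condition \<open>4 * r \<le> pi\<close> keeps every edge angle within \<pi>/2, where the lower
  bound on the factors applies.\<close>

lemma edge_product_ge_central:
  assumes A: "A \<subseteq> {1..n}"
    and small: "\<And>j. j \<in> A \<Longrightarrow> \<bar>t j\<bar> \<le> s" and "real n * s\<^sup>2 \<le> 1"
    and r: "\<And>k. k \<in> {1..n} \<Longrightarrow> \<bar>t k\<bar> \<le> r" "4 * r \<le> pi"
    and L: "(\<Sum>k\<in>{1..n} - A. 1 - cos (t k)) \<le> L"
  shows "exp (- (real (card A) * (1 + L))) * edge_product \<zeta> {e \<in> pairs n. e \<subseteq> {1..n} - A} t
    \<le> edge_product \<zeta> (pairs n) t"
proof -
  let ?B = "{1..n} - A"
  have fin: "finite A" using A finite_subset by blast
  have sq: "1 - cos (t j) \<le> s\<^sup>2 / 2" if "j \<in> A" for j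
  proof -
    have "\<bar>t j\<bar>\<^sup>2 \<le> s\<^sup>2" using small[OF that] by (intro power_mono) auto
    then show ?thesis using one_minus_cos_le_square[of "t j"] by simp
  qed
  have "card A \<le> n" using card_mono[OF _ A] by simp
  then have "real (card A) * s\<^sup>2 \<le> real n * s\<^sup>2" by (intro mult_right_mono) auto
  moreover have "(\<Sum>k\<in>A. 1 - cos (t k)) \<le> real (card A) * (s\<^sup>2 / 2)"
    using sum_mono[of A "\<lambda>k. 1 - cos (t k)" "\<lambda>_. s\<^sup>2 / 2"] sq by simp
  ultimately have "(\<Sum>k\<in>A. 1 - cos (t k)) \<le> 1 / 2" using \<open>real n * s\<^sup>2 \<le> 1\<close> by simp
  moreover have "(\<Sum>k\<in>{1..n}. 1 - cos (t k)) = (\<Sum>k\<in>?B. 1 - cos (t k)) + (\<Sum>k\<in>A. 1 - cos (t k))"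
    using A by (intro sum.subset_diff) auto
  ultimately have total: "(\<Sum>k\<in>{1..n}. 1 - cos (t k)) \<le> 1 / 2 + L" using L by simp
  \<comment> \<open>The terms of \<open>t j\<close> sum to at most n s^2 \<le> 1, and the remaining
    terms to at most 1 + 2L. The resulting factor 2 is cancelled by the 1/2 in the exponent of
    \<open>edge_product_ge\<close>.\<close>
  have row: "(\<Sum>k\<in>{1..n} - {j}. defect t {j, k}) \<le> 2 * (1 + L)" if j: "j \<in> A" for j
  proof -
    have "(\<Sum>k\<in>{1..n} - {j}. defect t {j, k}) \<le> (\<Sum>k\<in>{1..n} - {j}. 2 * (1 - cos (t j)) + 2 * (1 - cos (t k)))"
    proof (rule sum_mono)
      fix k assume "k \<in> {1..n} - {j}"
      then have "defect t {j, k} = 1 - cos (t j + t k)" by (intro defect_doubleton) auto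
      then show "defect t {j, k} \<le> 2 * (1 - cos (t j)) + 2 * (1 - cos (t k))"
        using one_minus_cos_add_le[of "t j" "t k"] by linarith
    qed
    also have "\<dots> \<le> (\<Sum>k\<in>{1..n}. 2 * (1 - cos (t j)) + 2 * (1 - cos (t k)))"
      by (intro sum_mono2) auto
    also have "\<dots> = 2 * (real n * (1 - cos (t j))) + 2 * (\<Sum>k\<in>{1..n}. 1 - cos (t k))"
      by (simp only: sum.distrib flip: sum_distrib_left) simp
    also have "\<dots> \<le> 2 * (real n * (s\<^sup>2 / 2)) + 2 * (1 / 2 + L)"
      using sq[OF j] total by (intro add_mono mult_left_mono) auto
    also have "\<dots> \<le> 2 * (1 + L)" using \<open>real n * s\<^sup>2 \<le> 1\<close> by simp
    finally show ?thesis .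
  qed
  have "(\<Sum>e | e \<in> pairs n \<and> \<not> e \<subseteq> ?B. defect t e) \<le> (\<Sum>j\<in>A. \<Sum>k\<in>{1..n} - {j}. defect t {j, k})"
    by (intro sum_meeting_pairs_le A) simp
  also have "\<dots> \<le> (\<Sum>j\<in>A. 2 * (1 + L))"
    by (rule sum_mono[OF row])
  also have "\<dots> = 2 * (real (card A) * (1 + L))" by simp
  finally have "exp (- (real (card A) * (1 + L))) \<le>
      exp (- ((\<Sum>e | e \<in> pairs n \<and> \<not> e \<subseteq> ?B. defect t e) / 2))"
    by simp
  also have "\<dots> \<le> edge_product \<zeta> {e \<in> pairs n. \<not> e \<subseteq> ?B} t"
  proof (rule edge_product_ge)
    fix e assume "e \<in> {e \<in> pairs n. \<not> e \<subseteq> ?B}"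
    then obtain j k where jk: "e = {j, k}" "j \<noteq> k" "j \<in> {1..n}" "k \<in> {1..n}"
      by (auto simp: pairs_def)
    then have "\<bar>t j + t k\<bar> \<le> pi / 2" using r(1)[of j] r(1)[of k] r(2) by linarith
    then have "0 \<le> cos (t j + t k)" by (intro cos_ge_zero) (simp_all only: abs_le_iff, linarith+)
    then show "0 \<le> cos (\<Sum>j\<in>e. t j)" using jk by simp
  qed auto
  finally show ?thesis
    unfolding edge_product_split[of t ?B] mult.commute[of _ "edge_product \<zeta> {e \<in> pairs n. e \<subseteq> ?B} t"]
    by (intro mult_left_mono edge_product_nonneg) auto
qed

end

subsection \<open>Pulling outlying coordinates to the origin\<close>

lemma product_sigma_finite_lborel: "product_sigma_finite (\<lambda>_ :: nat. lborel :: real measure)"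
  by standard

lemma emeasure_PiM_lborel_box:
  fixes a b :: real
  assumes "finite J" "a \<le> b"
  shows "emeasure (Pi\<^sub>M J (\<lambda>_ :: nat. lborel)) (J \<rightarrow>\<^sub>E {a..b}) = ennreal ((b - a) ^ card J)"
proof -
  interpret product_sigma_finite "\<lambda>_ :: nat. lborel :: real measure"
    by (rule product_sigma_finite_lborel)
  show ?thesis using assms by (simp add: emeasure_PiM ennreal_power)
qed

lemma box_in_sets_PiM_lborel:
  fixes a b :: real
  shows "finite J \<Longrightarrow> J \<rightarrow>\<^sub>E {a..b} \<in> sets (Pi\<^sub>M J (\<lambda>_ :: nat. lborel))"
  by (intro sets_PiM_I_finite) auto

text \<open>Requiring \<open>A\<close> to be exactly the set of coordinates beyond \<open>r\<close>
  makes these regions, for nonempty \<open>A\<close>, a partition of the cluster at the origin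
  outside the box.\<close>

definition outlier_region :: "nat \<Rightarrow> real \<Rightarrow> real \<Rightarrow> nat set \<Rightarrow> (nat \<Rightarrow> real) set" where
  "outlier_region n r L A =
    {t \<in> cube n. (\<forall>j\<in>{1..n}. (r < \<bar>t j\<bar>) = (j \<in> A)) \<and> (\<Sum>j\<in>{1..n}. 1 - cos (t j)) \<le> L}"

text \<open>The radius is free because two boxes occur: \<U>-type boxes of radius ln n / sqrt n, and
  the smaller box of radius 1 / sqrt n used for lower bounds.\<close>

definition box_region :: "nat \<Rightarrow> real \<Rightarrow> (nat \<Rightarrow> real) set" where
  "box_region n r = {t \<in> {1..n} \<rightarrow>\<^sub>E UNIV. \<forall>j\<in>{1..n}. \<bar>t j\<bar> \<le> r}"

lemma space_lebesgue_space: "space (lebesgue_space n) = {1..n} \<rightarrow>\<^sub>E UNIV"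
  by (simp add: lebesgue_space_def space_PiM)

lemma cube_in_sets: "cube n \<in> sets (lebesgue_space n)"
  unfolding cube_def lebesgue_space_def by (intro box_in_sets_PiM_lborel) simp

lemma abs_le_iff_atLeastAtMost: "\<bar>x\<bar> \<le> r \<longleftrightarrow> x \<in> {-r..r}" for x r :: real
  by auto

lemma box_region_eq: "box_region n r = {1..n} \<rightarrow>\<^sub>E {-r..r}"
  unfolding box_region_def abs_le_iff_atLeastAtMost by (auto simp: PiE_iff extensional_def)

lemma box_region_in_sets: "box_region n r \<in> sets (lebesgue_space n)"
  unfolding box_region_eq lebesgue_space_def by (intro box_in_sets_PiM_lborel) simp

lemma outlier_region_in_sets: "outlier_region n r L A \<in> sets (lebesgue_space n)"
proof -
  have "{t \<in> space (lebesgue_space n). (\<forall>j\<in>{1..n}. (r < \<bar>t j\<bar>) = (j \<in> A)) \<and> (\<Sum>j\<in>{1..n}. 1 - cos (t j)) \<le> L}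
      \<in> sets (lebesgue_space n)"
    unfolding lebesgue_space_def by measurable
  then have "{t \<in> space (lebesgue_space n). (\<forall>j\<in>{1..n}. (r < \<bar>t j\<bar>) = (j \<in> A)) \<and> (\<Sum>j\<in>{1..n}. 1 - cos (t j)) \<le> L}
      \<inter> cube n \<in> sets (lebesgue_space n)"
    using cube_in_sets by (rule sets.Int)
  also have "{t \<in> space (lebesgue_space n). (\<forall>j\<in>{1..n}. (r < \<bar>t j\<bar>) = (j \<in> A)) \<and> (\<Sum>j\<in>{1..n}. 1 - cos (t j)) \<le> L}
      \<inter> cube n = outlier_region n r L A"
    by (auto simp: outlier_region_def space_lebesgue_space cube_def)
  finally show ?thesis .
qed

lemma merge_in_PiE:
  assumes "b \<in> B \<rightarrow>\<^sub>E X" "a \<in> A \<rightarrow>\<^sub>E X"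
  shows "merge B A (b, a) \<in> (B \<union> A) \<rightarrow>\<^sub>E X"
  using assms by (auto simp: merge_def PiE_def Pi_def extensional_def)

context edge_parameters begin

text \<open>Integrate over the coordinates in \<open>A\<close> first, with the others fixed.
  Outlying coordinates fill at most a box of volume (2\<pi>)^m and carry the upper bound
  \<open>K1\<close>; central ones contain a box of volume (2s)^m and carry the lower bound
  \<open>K2\<close>. Both estimates share the integral \<open>J\<close> over the fixed coordinates,
  so the ratio is at most the m-th power of the ratio for one coordinate, which the hypothesis on
  \<open>\<rho>\<close> controls.\<close>

lemma nn_integral_outlier_region_le:
  fixes r s L \<rho> :: real
  assumes A: "A \<subseteq> {1..n}" and card: "2 * card A \<le> n"
    and r: "0 < s" "s \<le> r" "4 * r \<le> pi" and s: "real n * s\<^sup>2 \<le> 1"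
    and \<rho>: "pi * exp (1 + L) * exp (- (\<delta> / 2 * (real n * r\<^sup>2 / 32 - L))) \<le> \<rho> * s"
  shows "(\<integral>\<^sup>+t. ennreal (edge_product \<zeta> (pairs n) t) * indicator (outlier_region n r L A) t \<partial>lebesgue_space n)
    \<le> ennreal (\<rho> ^ card A) *
      (\<integral>\<^sup>+t. ennreal (edge_product \<zeta> (pairs n) t) * indicator (box_region n r) t \<partial>lebesgue_space n)"
proof -
  interpret product_sigma_finite "\<lambda>_ :: nat. lborel :: real measure"
    by (rule product_sigma_finite_lborel)
  define B where "B = {1..n} - A"
  define M where "M J = Pi\<^sub>M J (\<lambda>_ :: nat. lborel :: real measure)" for J
  define G where "G = edge_product \<zeta> (pairs n)"
  define H where "H = edge_product \<zeta> {e \<in> pairs n. e \<subseteq> B}"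
  define m where "m = card A"
  \<comment> \<open>The constraints on the fixed coordinates alone; they serve the upper and the
    lower estimate alike.\<close>
  define Q where "Q = {b \<in> space (M B). (\<forall>k\<in>B. \<bar>b k\<bar> \<le> r) \<and> (\<Sum>k\<in>B. 1 - cos (b k)) \<le> L}"
  define K1 where "K1 = exp (- (\<delta> / 2 * (real m * (real n * r\<^sup>2 / 32 - L))))"
  define K2 where "K2 = exp (- (real m * (1 + L)))"
  define J where "J = (\<integral>\<^sup>+b. ennreal (H b) * indicator Q b \<partial>M B)"
  have fin: "finite A" "finite B" using A finite_subset by (auto simp: B_def)
  have AB: "B \<union> A = {1..n}" "B \<inter> A = {}" using A by (auto simp: B_def)
  have leb: "lebesgue_space n = M (B \<union> A)" by (simp add: M_def AB lebesgue_space_def)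
  have spM: "space (M J) = J \<rightarrow>\<^sub>E UNIV" for J by (simp add: M_def space_PiM)
  have G_meas [measurable]: "G \<in> borel_measurable (M (B \<union> A))"
    unfolding G_def M_def AB by (intro measurable_edge_product pairs_subset)
  have H_meas [measurable]: "H \<in> borel_measurable (M B)"
    unfolding H_def M_def by (intro measurable_edge_product) auto
  have [measurable]: "Q \<in> sets (M B)"
    using fin unfolding Q_def M_def by measurable
  have [measurable]: "outlier_region n r L A \<in> sets (M (B \<union> A))"
    "box_region n r \<in> sets (M (B \<union> A))"
    unfolding leb[symmetric] by (rule outlier_region_in_sets box_region_in_sets)+
  have A_box [measurable]: "A \<rightarrow>\<^sub>E {-x..x} \<in> sets (M A)" for x :: real
    unfolding M_def using fin by (intro box_in_sets_PiM_lborel)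
  have merge_simps: "merge B A (b, a) j = a j" if "j \<in> A" for a b :: "nat \<Rightarrow> real" and j
    using that AB by (auto simp: merge_def)
  have merge_simps': "merge B A (b, a) j = b j" if "j \<in> B" for a b :: "nat \<Rightarrow> real" and j
    using that by (auto simp: merge_def)
  have H_merge: "H (merge B A (b, a)) = H b" for a b
    unfolding H_def by (intro edge_product_cong merge_simps') auto
  have sum_merge: "(\<Sum>k\<in>B. 1 - cos (merge B A (b, a) k)) = (\<Sum>k\<in>B. 1 - cos (b k))"
    for a b :: "nat \<Rightarrow> real"
    by (intro sum.cong refl) (simp add: merge_simps')
  have pos: "0 \<le> K1" "0 \<le> K2" "0 \<le> H b" for b
    by (auto simp: K1_def K2_def H_def intro: edge_product_nonneg)
  have fold: "(\<integral>\<^sup>+t. f t \<partial>M (B \<union> A)) = (\<integral>\<^sup>+b. (\<integral>\<^sup>+a. f (merge B A (b, a)) \<partial>M A) \<partial>M B)"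
    if "f \<in> borel_measurable (M (B \<union> A))" for f
    using that AB fin unfolding M_def by (intro product_nn_integral_fold) auto
  have rect: "(\<integral>\<^sup>+b. (\<integral>\<^sup>+a. ennreal K * (ennreal (H b) * indicator Q b) * indicator (A \<rightarrow>\<^sub>E {-x..x}) a \<partial>M A) \<partial>M B)
      = ennreal (K * (2 * x) ^ m) * J" if "0 \<le> K" "0 \<le> x" for K x
  proof -
    have "(\<integral>\<^sup>+b. (\<integral>\<^sup>+a. ennreal K * (ennreal (H b) * indicator Q b) * indicator (A \<rightarrow>\<^sub>E {-x..x}) a \<partial>M A) \<partial>M B)
      = (\<integral>\<^sup>+b. ennreal K * (ennreal (H b) * indicator Q b) * ennreal ((2 * x) ^ m) \<partial>M B)"
      using emeasure_PiM_lborel_box[OF fin(1), of "- x" x] that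
      by (subst nn_integral_cmult_indicator) (auto simp: A_box m_def simp flip: M_def)
    also have "\<dots> = (\<integral>\<^sup>+b. ennreal (K * (2 * x) ^ m) * (ennreal (H b) * indicator Q b) \<partial>M B)"
      using that by (simp add: ennreal_mult mult_ac)
    also have "\<dots> = ennreal (K * (2 * x) ^ m) * J"
      unfolding J_def by (intro nn_integral_cmult) measurable
    finally show ?thesis .
  qed
  have upper: "(\<integral>\<^sup>+t. ennreal (G t) * indicator (outlier_region n r L A) t \<partial>M (B \<union> A))
      \<le> ennreal (K1 * (2 * pi) ^ m) * J"
  proof -
    have "ennreal (G t) * indicator (outlier_region n r L A) t
        \<le> ennreal K1 * (ennreal (H b) * indicator Q b) * indicator (A \<rightarrow>\<^sub>E {-pi..pi}) a"
      if "b \<in> space (M B)" "a \<in> space (M A)" "t = merge B A (b, a)" for a b t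
    proof (cases "t \<in> outlier_region n r L A")
      case True
      note t = this[unfolded outlier_region_def]
      have t_cube: "t j \<in> {-pi..pi}" if "j \<in> {1..n}" for j
        using t that unfolding cube_def by blast
      have t_far: "r < \<bar>t j\<bar> \<longleftrightarrow> j \<in> A" if "j \<in> {1..n}" for j
        using t that by blast
      have a_box: "a \<in> A \<rightarrow>\<^sub>E {-pi..pi}"
      proof (rule PiE_I)
        fix j assume "j \<in> A"
        then show "a j \<in> {-pi..pi}" using t_cube[of j] A merge_simps[of j b a] that(3) by auto
      next
        fix j assume "j \<notin> A" then show "a j = undefined" using that(2) by (auto simp: spM)
      qed
      \<comment> \<open>The terms are nonnegative, so the bound \<open>L\<close> on the whole sum
        passes to the coordinates in \<open>B\<close>.\<close>
      have "(\<Sum>k\<in>B. 1 - cos (t k)) \<le> (\<Sum>k\<in>{1..n}. 1 - cos (t k))"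
        by (intro sum_mono2) (auto simp: B_def)
      then have sum: "(\<Sum>k\<in>B. 1 - cos (t k)) \<le> L" using t by auto
      have "\<bar>b k\<bar> \<le> r" if "k \<in> B" for k
        using t_far[of k] that merge_simps'[OF that, of b a] \<open>t = _\<close> by (auto simp: B_def not_less)
      then have "b \<in> Q" using sum \<open>b \<in> space (M B)\<close> unfolding \<open>t = _\<close> sum_merge by (simp add: Q_def)
      have "G t \<le> K1 * H t"
        unfolding G_def K1_def H_def B_def m_def
      proof (rule edge_product_le_outlying[OF A card])
        fix j assume "j \<in> A"
        then show "r \<le> \<bar>t j\<bar> \<and> \<bar>t j\<bar> \<le> pi" using t_cube[of j] t_far[of j] A
          by (auto simp: abs_le_iff_atLeastAtMost)
      qed (use r sum in \<open>auto simp: B_def\<close>)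
      then have "G t \<le> K1 * H b" by (simp add: \<open>t = _\<close> H_merge)
      then show ?thesis using \<open>b \<in> Q\<close> a_box True pos by (simp flip: ennreal_mult)
    qed simp
    then show ?thesis
      \<comment> \<open>Fubini makes the left side an iterated integral, and \<open>rect\<close>
        read backwards does the same for the right side; the pointwise bound then applies.\<close>
      using pos by (subst fold, measurable, subst rect[symmetric], simp, simp, intro nn_integral_mono) auto
  qed
  have lower: "ennreal (K2 * (2 * s) ^ m) * J
      \<le> (\<integral>\<^sup>+t. ennreal (G t) * indicator (box_region n r) t \<partial>M (B \<union> A))"
  proof -
    have "ennreal K2 * (ennreal (H b) * indicator Q b) * indicator (A \<rightarrow>\<^sub>E {-s..s}) a
        \<le> ennreal (G t) * indicator (box_region n r) t"
      if "b \<in> space (M B)" "a \<in> space (M A)" "t = merge B A (b, a)" for a b t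
    proof (cases "b \<in> Q \<and> a \<in> A \<rightarrow>\<^sub>E {-s..s}")
      case True
      have a: "\<bar>t j\<bar> \<le> s" if "j \<in> A" for j
        using that True merge_simps[OF that, of b a] \<open>t = _\<close> by (auto simp: abs_le_iff_atLeastAtMost PiE_iff)
      have b: "\<bar>t k\<bar> \<le> r" if "k \<in> B" for k
        using that True merge_simps'[OF that, of b a] \<open>t = _\<close> by (auto simp: Q_def)
      have ab: "\<bar>t k\<bar> \<le> r" if "k \<in> {1..n}" for k
        using a b \<open>s \<le> r\<close> that AB by (metis Un_iff order_trans)
      have "t \<in> {1..n} \<rightarrow>\<^sub>E UNIV"
        using merge_in_PiE[of b B UNIV a A] that AB by (simp add: spM)
      then have "t \<in> box_region n r" using ab by (simp add: box_region_def)
      have "K2 * H t \<le> G t"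
        unfolding G_def K2_def H_def B_def m_def
      proof (rule edge_product_ge_central[OF A a s ab r(3)])
        show "(\<Sum>k\<in>{1..n} - A. 1 - cos (t k)) \<le> L"
          unfolding B_def[symmetric] \<open>t = _\<close> sum_merge using True by (simp add: Q_def)
      qed
      then have "K2 * H b \<le> G t" by (simp add: \<open>t = _\<close> H_merge)
      then show ?thesis using True \<open>t \<in> box_region n r\<close> pos by (simp add: ennreal_leI flip: ennreal_mult)
    next
      case False
      then show ?thesis by (cases "b \<in> Q") simp_all
    qed
    then show ?thesis
      using pos r by (subst fold, measurable, subst rect[symmetric], simp, simp, intro nn_integral_mono) auto
  qed
  have "0 \<le> \<rho>"
  proof -
    have "0 < \<rho> * s" using \<rho> by (rule less_le_trans[rotated]) simp
    then show ?thesis using r by (simp add: zero_less_mult_iff)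
  qed
  have K1: "K1 = exp (- (\<delta> / 2 * (real n * r\<^sup>2 / 32 - L))) ^ m"
    unfolding K1_def exp_of_nat_mult[symmetric] by (simp add: mult_ac)
  have K2: "exp (1 + L) ^ m * K2 = 1"
    unfolding K2_def exp_of_nat_mult[symmetric] by (simp flip: exp_add)
  \<comment> \<open>Inserting \<open>exp (1 + L) ^ m * K2 = 1\<close> collects everything but
    \<open>K2\<close> into an m-th power, to which the hypothesis on \<open>\<rho>\<close>
    applies.\<close>
  have "K1 * (2 * pi) ^ m = K1 * (2 * pi) ^ m * (exp (1 + L) ^ m * K2)" by (simp add: K2)
  also have "\<dots> = (2 * (pi * exp (1 + L) * exp (- (\<delta> / 2 * (real n * r\<^sup>2 / 32 - L))))) ^ m * K2"
    unfolding K1 by (simp only: power_mult_distrib mult_ac)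
  also have "\<dots> \<le> (2 * (\<rho> * s)) ^ m * K2"
    using \<rho> pos by (intro mult_right_mono power_mono mult_left_mono) auto
  also have "\<dots> = \<rho> ^ m * (K2 * (2 * s) ^ m)" by (simp add: power_mult_distrib)
  finally have "ennreal (K1 * (2 * pi) ^ m) * J \<le> ennreal (\<rho> ^ m * (K2 * (2 * s) ^ m)) * J"
    by (intro mult_right_mono ennreal_leI) auto
  also have "\<dots> = ennreal (\<rho> ^ m) * (ennreal (K2 * (2 * s) ^ m) * J)"
    using \<open>0 \<le> \<rho>\<close> pos r by (simp add: ennreal_mult mult.assoc)
  also have "\<dots> \<le> ennreal (\<rho> ^ m) * (\<integral>\<^sup>+t. ennreal (G t) * indicator (box_region n r) t \<partial>M (B \<union> A))"
    by (intro mult_left_mono lower) simp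
  finally show ?thesis using upper unfolding leb G_def m_def by (rule order_trans[rotated])
qed

end

subsection \<open>Turning all coordinates by half a period\<close>

text \<open>Translation by \<pi> modulo 2\<pi>, realised by exchanging the two halves of
  [-\<pi>, \<pi>]. It is the identity elsewhere so that Lebesgue measure on the whole line is
  preserved.\<close>

definition half_turn :: "real \<Rightarrow> real" where
  "half_turn x = (if -pi \<le> x \<and> x < 0 then x + pi else if 0 \<le> x \<and> x \<le> pi then x - pi else x)"

lemma measurable_half_turn [measurable]: "half_turn \<in> borel_measurable borel"
  unfolding half_turn_def[abs_def] by measurable

lemma cos_half_turn: "x \<in> {-pi..pi} \<Longrightarrow> cos (half_turn x) = - cos x"
  by (auto simp: half_turn_def)

lemma cos_half_turn_add:
  assumes "x \<in> {-pi..pi}" "y \<in> {-pi..pi}"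
  shows "cos (half_turn x + half_turn y) = cos (x + y)"
proof -
  have "sin (half_turn x) = - sin x" "sin (half_turn y) = - sin y"
    using assms by (auto simp: half_turn_def)
  then show ?thesis using assms by (simp add: cos_add cos_half_turn)
qed

lemma half_turn_in_range: "x \<in> {-pi..pi} \<Longrightarrow> half_turn x \<in> {-pi..pi}"
  by (auto simp: half_turn_def)

lemma nn_integral_half_turn:
  fixes f :: "real \<Rightarrow> ennreal"
  assumes [measurable]: "f \<in> borel_measurable borel"
  shows "(\<integral>\<^sup>+x. f (half_turn x) \<partial>lborel) = (\<integral>\<^sup>+x. f x \<partial>lborel)"
proof -
  have "(\<integral>\<^sup>+x. f (half_turn x) \<partial>lborel) =
     (\<integral>\<^sup>+x. f (x + pi) * indicator {-pi..<0} x + f (x - pi) * indicator {0..pi} x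
        + f x * indicator (- {-pi..pi}) x \<partial>lborel)"
    by (intro nn_integral_cong) (auto simp: half_turn_def indicator_def)
  also have "\<dots> = (\<integral>\<^sup>+x. f (x + pi) * indicator {-pi..<0} x \<partial>lborel)
      + (\<integral>\<^sup>+x. f (x - pi) * indicator {0..pi} x \<partial>lborel)
      + (\<integral>\<^sup>+x. f x * indicator (- {-pi..pi}) x \<partial>lborel)"
    by (simp add: nn_integral_add)
  also have "(\<integral>\<^sup>+x. f (x + pi) * indicator {-pi..<0} x \<partial>lborel) = (\<integral>\<^sup>+x. f x * indicator {0..<pi} x \<partial>lborel)"
    by (subst (2) nn_integral_real_affine[where c=1 and t=pi])
      (auto intro!: nn_integral_cong simp: indicator_def add.commute)
  also have "(\<integral>\<^sup>+x. f (x - pi) * indicator {0..pi} x \<partial>lborel) = (\<integral>\<^sup>+x. f x * indicator {-pi..0} x \<partial>lborel)"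
    by (subst (2) nn_integral_real_affine[where c=1 and t="-pi"])
      (auto intro!: nn_integral_cong simp: indicator_def)
  also have "(\<integral>\<^sup>+x. f x * indicator {0..<pi} x \<partial>lborel) + (\<integral>\<^sup>+x. f x * indicator {-pi..0} x \<partial>lborel)
      + (\<integral>\<^sup>+x. f x * indicator (- {-pi..pi}) x \<partial>lborel)
    = (\<integral>\<^sup>+x. f x * indicator {0..<pi} x + f x * indicator {-pi..0} x + f x * indicator (- {-pi..pi}) x \<partial>lborel)"
    by (simp add: nn_integral_add)
  \<comment> \<open>The pieces cover the line except that 0 is counted twice and \<pi> is missed,
    which is a null set.\<close>
  also have "\<dots> = (\<integral>\<^sup>+x. f x \<partial>lborel)"
  proof (rule nn_integral_cong_AE)
    show "AE x in lborel. f x * indicator {0..<pi} x + f x * indicator {-pi..0} x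
        + f x * indicator (- {-pi..pi}) x = f x"
      using AE_lborel_singleton[of 0] AE_lborel_singleton[of pi]
      by eventually_elim (auto simp: indicator_def)
  qed
  finally show ?thesis .
qed

lemma distr_half_turn: "distr lborel lborel half_turn = lborel"
proof (rule measure_eqI)
  fix A assume "A \<in> sets (distr lborel lborel half_turn)"
  then have [measurable]: "A \<in> sets borel" by simp
  have "emeasure (distr lborel lborel half_turn) A = (\<integral>\<^sup>+x. indicator A x \<partial>distr lborel lborel half_turn)"
    by simp
  also have "\<dots> = (\<integral>\<^sup>+x. indicator A (half_turn x) \<partial>lborel)" by (intro nn_integral_distr) auto
  also have "\<dots> = emeasure lborel A" by (subst nn_integral_half_turn) auto
  finally show "emeasure (distr lborel lborel half_turn) A = emeasure lborel A" .
qed simp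

definition half_turns :: "nat \<Rightarrow> (nat \<Rightarrow> real) \<Rightarrow> (nat \<Rightarrow> real)" where
  "half_turns n t = (\<lambda>j\<in>{1..n}. half_turn (t j))"

lemma half_turns_apply [simp]: "j \<in> {1..n} \<Longrightarrow> half_turns n t j = half_turn (t j)"
  by (simp add: half_turns_def)

lemma measurable_half_turns: "half_turns n \<in> measurable (lebesgue_space n) (lebesgue_space n)"
  unfolding half_turns_def[abs_def] lebesgue_space_def
proof (rule measurable_restrict)
  fix j assume "j \<in> {1..n}"
  then have "(\<lambda>t. half_turn (t j)) \<in> borel_measurable (Pi\<^sub>M {1..n} (\<lambda>_. lborel))"
    by (intro measurable_compose[OF borel_measurable_coordinate measurable_half_turn])
  then show "(\<lambda>t. half_turn (t j)) \<in> measurable (Pi\<^sub>M {1..n} (\<lambda>_. lborel)) lborel"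
    by (simp only: measurable_lborel1)
qed

text \<open>A product measure is determined by its values on measurable rectangles, and the preimage
  of a rectangle is the rectangle of the coordinatewise preimages.\<close>

lemma distr_half_turns: "distr (lebesgue_space n) (lebesgue_space n) (half_turns n) = lebesgue_space n"
  unfolding lebesgue_space_def
proof (rule product_sigma_finite.PiM_eqI)
  let ?P = "Pi\<^sub>M {1..n} (\<lambda>_. lborel :: real measure)"
  show "product_sigma_finite (\<lambda>_ :: nat. lborel :: real measure)" by standard
  then interpret product_sigma_finite "\<lambda>_ :: nat. lborel :: real measure" .
  fix A :: "nat \<Rightarrow> real set" assume A: "\<And>i. i \<in> {1..n} \<Longrightarrow> A i \<in> sets lborel"
  have meas: "half_turn -` A i \<in> sets lborel" if "i \<in> {1..n}" for i
    using measurable_sets[OF measurable_half_turn, of "A i"] A[OF that] by simp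
  have eq: "half_turns n -` Pi\<^sub>E {1..n} A \<inter> space ?P = (\<Pi>\<^sub>E i\<in>{1..n}. half_turn -` A i)"
    by (auto simp: space_PiM PiE_iff half_turns_def)
  have "emeasure (distr ?P ?P (half_turns n)) (Pi\<^sub>E {1..n} A) = emeasure ?P (\<Pi>\<^sub>E i\<in>{1..n}. half_turn -` A i)"
    using measurable_half_turns A unfolding lebesgue_space_def
    by (subst emeasure_distr) (auto simp only: eq intro!: sets_PiM_I_finite)
  also have "\<dots> = (\<Prod>i\<in>{1..n}. emeasure lborel (half_turn -` A i))"
    by (intro emeasure_PiM meas) auto
  also have "\<dots> = (\<Prod>i\<in>{1..n}. emeasure lborel (A i))"
  proof (rule prod.cong[OF refl])
    fix i assume "i \<in> {1..n}"
    then have "emeasure (distr lborel lborel half_turn) (A i) = emeasure lborel (half_turn -` A i)"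
      using A by (subst emeasure_distr) auto
    then show "emeasure lborel (half_turn -` A i) = emeasure lborel (A i)"
      by (simp add: distr_half_turn)
  qed
  finally show "emeasure (distr ?P ?P (half_turns n)) (Pi\<^sub>E {1..n} A) = (\<Prod>i\<in>{1..n}. emeasure lborel (A i))" .
qed auto

text \<open>Both endpoints of an edge are turned, so their sines and cosines all change sign and the
  cosine of the edge angle is unchanged.\<close>

lemma edge_product_half_turns:
  assumes "t \<in> cube n"
  shows "edge_product \<zeta> (pairs n) (half_turns n t) = edge_product \<zeta> (pairs n) t"
  unfolding edge_product_def
proof (rule prod.cong[OF refl])
  fix e assume "e \<in> pairs n"
  then obtain j k where e: "e = {j, k}" "j \<noteq> k" "j \<in> {1..n}" "k \<in> {1..n}"
    by (auto simp: pairs_def)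
  then have "t j \<in> {-pi..pi}" "t k \<in> {-pi..pi}" using assms unfolding cube_def by blast+
  then have "cos (\<Sum>j\<in>e. half_turns n t j) = cos (\<Sum>j\<in>e. t j)"
    using e cos_half_turn_add[of "t j" "t k"] by (simp del: atLeastAtMost_iff)
  then show "factor (\<zeta> e) (\<Sum>j\<in>e. half_turns n t j) = factor (\<zeta> e) (\<Sum>j\<in>e. t j)"
    by (simp add: factor_def)
qed

subsection \<open>Comparison of the integrals\<close>

lemma U_region_eq: "U_region n = box_region n (ln (real n) / sqrt (real n))"
  by (simp add: U_region_def box_region_def)

lemma W_region_in_sets: "W_region n \<in> sets (lebesgue_space n)"
proof -
  have "{t \<in> space (lebesgue_space n). \<forall>j\<in>{1..n}. \<bar>t j + pi\<bar> \<le> ln (real n) / sqrt (real n) \<or>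
      \<bar>t j - pi\<bar> \<le> ln (real n) / sqrt (real n)} \<in> sets (lebesgue_space n)"
    unfolding lebesgue_space_def by measurable
  then show ?thesis by (simp add: W_region_def space_lebesgue_space)
qed

text \<open>The binomial expansion over subsets; the subtracted 1 is the term of the empty
  set.\<close>

lemma sum_Pow_power_card:
  fixes \<rho> :: real
  assumes "finite I"
  shows "(\<Sum>A\<in>Pow I - {{}}. \<rho> ^ card A) = (1 + \<rho>) ^ card I - 1"
proof -
  have "(1 + \<rho>) ^ card I = (\<Prod>x\<in>I. \<rho> + 1)" by (simp add: add.commute)
  also have "\<dots> = (\<Sum>A\<in>Pow I. \<rho> ^ card A)" using assms by (subst prod_add) simp_all
  also have "\<dots> = 1 + (\<Sum>A\<in>Pow I - {{}}. \<rho> ^ card A)"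
    using assms by (subst sum.remove[of _ "{}"]) auto
  finally show ?thesis by simp
qed

section \<open>Regions covering the cube\<close>

text \<open>\<open>\<sigma> = 1\<close> gives the points clustering at the origin, \<open>\<sigma> = -1\<close> those clustering at \<open>\<plusminus>\<pi>\<close>.\<close>

definition cluster_region :: "nat \<Rightarrow> real \<Rightarrow> real \<Rightarrow> (nat \<Rightarrow> real) set" where
  "cluster_region n \<sigma> L = {t \<in> cube n. (\<Sum>j\<in>{1..n}. 1 - \<sigma> * cos (t j)) \<le> L}"

definition defect_region :: "nat \<Rightarrow> real \<Rightarrow> (nat \<Rightarrow> real) set" where
  "defect_region n T = {t \<in> cube n. T < (\<Sum>e\<in>pairs n. defect t e)}"

lemma cluster_region_in_sets: "cluster_region n \<sigma> L \<in> sets (lebesgue_space n)"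
proof -
  have "{t \<in> space (lebesgue_space n). (\<Sum>j\<in>{1..n}. 1 - \<sigma> * cos (t j)) \<le> L} \<in> sets (lebesgue_space n)"
    unfolding lebesgue_space_def by measurable
  then have "{t \<in> space (lebesgue_space n). (\<Sum>j\<in>{1..n}. 1 - \<sigma> * cos (t j)) \<le> L} \<inter> cube n
      \<in> sets (lebesgue_space n)"
    using cube_in_sets by (rule sets.Int)
  also have "{t \<in> space (lebesgue_space n). (\<Sum>j\<in>{1..n}. 1 - \<sigma> * cos (t j)) \<le> L} \<inter> cube n
      = cluster_region n \<sigma> L"
    by (auto simp: cluster_region_def space_lebesgue_space cube_def)
  finally show ?thesis .
qed

lemma defect_region_in_sets: "defect_region n T \<in> sets (lebesgue_space n)"
proof -
  have angle: "(\<lambda>t. \<Sum>j\<in>e. t j) \<in> borel_measurable (Pi\<^sub>M {1..n} (\<lambda>_. lborel))" if "e \<in> pairs n" for e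
    using pairs_subset[OF that] by (intro borel_measurable_sum borel_measurable_coordinate) auto
  have "(\<lambda>t. defect t e) \<in> borel_measurable (Pi\<^sub>M {1..n} (\<lambda>_. lborel))" if "e \<in> pairs n" for e
    unfolding defect_def
    by (intro borel_measurable_diff borel_measurable_const measurable_compose[OF angle[OF that] borel_measurable_cos])
  then have "(\<lambda>t. \<Sum>e\<in>pairs n. defect t e) \<in> borel_measurable (lebesgue_space n)"
    unfolding lebesgue_space_def by (intro borel_measurable_sum)
  then have "{t \<in> space (lebesgue_space n). T < (\<Sum>e\<in>pairs n. defect t e)} \<in> sets (lebesgue_space n)"
    by (intro borel_measurable_less) auto
  then have "{t \<in> space (lebesgue_space n). T < (\<Sum>e\<in>pairs n. defect t e)} \<inter> cube n \<in> sets (lebesgue_space n)"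
    using cube_in_sets by (rule sets.Int)
  also have "{t \<in> space (lebesgue_space n). T < (\<Sum>e\<in>pairs n. defect t e)} \<inter> cube n = defect_region n T"
    by (auto simp: defect_region_def space_lebesgue_space cube_def)
  finally show ?thesis .
qed

text \<open>Let X be the cosine sum. If the total defect is at most n l, then (n - |X|)(n + |X|)
  \<le> (2l + 2) n, and n + |X| \<ge> n gives n - |X| \<le> 2l + 2. The sign of X decides between
  the two clusters.\<close>

lemma cube_cover:
  assumes "0 < n"
  shows "cube n \<subseteq> defect_region n (real n * l) \<union> cluster_region n 1 (2 * l + 2) \<union> cluster_region n (-1) (2 * l + 2)"
proof
  fix t assume t: "t \<in> cube n"
  let ?X = "\<Sum>j\<in>{1..n}. cos (t j)"
  show "t \<in> defect_region n (real n * l) \<union> cluster_region n 1 (2 * l + 2) \<union> cluster_region n (-1) (2 * l + 2)"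
  proof (cases "t \<in> defect_region n (real n * l)")
    case False
    then have "(\<Sum>e\<in>pairs n. defect t e) \<le> real n * l" using t by (simp add: defect_region_def)
    then have 1: "(real n)\<^sup>2 - ?X\<^sup>2 \<le> (2 * l + 2) * real n"
      using cos_sum_square_ge[of n t] by (simp add: algebra_simps)
    have "\<bar>?X\<bar> \<le> (\<Sum>j\<in>{1..n}. \<bar>cos (t j)\<bar>)" by (rule sum_abs)
    also have "\<dots> \<le> (\<Sum>j\<in>{1..n}. 1)" by (intro sum_mono) simp
    finally have "\<bar>?X\<bar> \<le> real n" by simp
    then have "(real n - \<bar>?X\<bar>) * real n \<le> (real n - \<bar>?X\<bar>) * (real n + \<bar>?X\<bar>)"
      by (intro mult_left_mono) auto
    also have "\<dots> = (real n)\<^sup>2 - ?X\<^sup>2"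
      by (simp add: algebra_simps flip: power2_eq_square)
    finally have "(real n - \<bar>?X\<bar>) * real n \<le> (2 * l + 2) * real n" using 1 by linarith
    then have "real n - \<bar>?X\<bar> \<le> 2 * l + 2" using assms by simp
    then have "real n - ?X \<le> 2 * l + 2 \<or> real n + ?X \<le> 2 * l + 2" by linarith
    then show ?thesis using t by (auto simp: cluster_region_def sum_subtractf sum.distrib)
  qed auto
qed

lemma half_turns_in_cube: "t \<in> cube n \<Longrightarrow> half_turns n t \<in> cube n"
  unfolding cube_def half_turns_def restrict_PiE_iff by (blast intro: half_turn_in_range)

lemma half_turns_cluster_region:
  assumes "t \<in> cluster_region n (-1) L"
  shows "half_turns n t \<in> cluster_region n 1 L"
proof -
  have t: "t \<in> cube n" "(\<Sum>j\<in>{1..n}. 1 - (-1) * cos (t j)) \<le> L"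
    using assms by (auto simp: cluster_region_def)
  have "(\<Sum>j\<in>{1..n}. 1 - 1 * cos (half_turns n t j)) = (\<Sum>j\<in>{1..n}. 1 - (-1) * cos (t j))"
  proof (rule sum.cong[OF refl])
    fix j assume j: "j \<in> {1..n}"
    then have "t j \<in> {-pi..pi}" using t unfolding cube_def by blast
    then show "1 - 1 * cos (half_turns n t j) = 1 - (-1) * cos (t j)"
      using j by (simp only: half_turns_apply cos_half_turn)
  qed
  then show ?thesis using t half_turns_in_cube by (simp only: cluster_region_def mem_Collect_eq)
qed

text \<open>A negative coordinate is moved by +\<pi> and a nonnegative one by -\<pi>, so closeness
  to 0 after the turn means closeness to -\<pi> or \<pi> before it.\<close>

lemma half_turns_box_region:
  assumes t: "t \<in> cube n" and "half_turns n t \<in> box_region n (ln (real n) / sqrt (real n))"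
  shows "t \<in> W_region n"
proof -
  have "\<exists>\<sigma>\<in>{-1, 1}. \<bar>t j - \<sigma> * pi\<bar> \<le> ln (real n) / sqrt (real n)" if j: "j \<in> {1..n}" for j
  proof -
    have "t j \<in> {-pi..pi}" using t j unfolding cube_def by blast
    moreover have "\<bar>half_turns n t j\<bar> \<le> ln (real n) / sqrt (real n)"
      using assms(2) j by (simp add: box_region_def)
    ultimately show ?thesis using j by (auto simp: half_turn_def split: if_splits)
  qed
  moreover have "t \<in> {1..n} \<rightarrow>\<^sub>E UNIV" using t by (auto simp: cube_def)
  ultimately show ?thesis unfolding W_region_def by blast
qed

section \<open>Masses of the regions\<close>

context edge_parameters begin

lemma edge_product_measurable: "edge_product \<zeta> (pairs n) \<in> borel_measurable (lebesgue_space n)"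
  unfolding lebesgue_space_def by (intro measurable_edge_product pairs_subset)

abbreviation mass :: "(nat \<Rightarrow> real) set \<Rightarrow> ennreal" where
  "mass R \<equiv> (\<integral>\<^sup>+t. ennreal (edge_product \<zeta> (pairs n) t) * indicator R t \<partial>lebesgue_space n)"

text \<open>Outside the box the set \<open>A\<close> of outlying coordinates is nonempty. Summing
  the bound \<rho>^|A| over all nonempty \<open>A\<close> gives (1 + \<rho>)^n - 1.\<close>

lemma mass_cluster_origin_le:
  fixes r s L \<rho> :: real
  assumes r: "0 < s" "s \<le> r" "4 * r \<le> pi" and s: "real n * s\<^sup>2 \<le> 1"
    and \<rho>: "pi * exp (1 + L) * exp (- (\<delta> / 2 * (real n * r\<^sup>2 / 32 - L))) \<le> \<rho> * s"
    and L: "16 * L \<le> real n * r\<^sup>2" and "0 \<le> \<rho>"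
  shows "mass (cluster_region n 1 L - box_region n r) \<le> ennreal ((1 + \<rho>) ^ n - 1) * mass (box_region n r)"
proof -
  let ?P = "Pow {1..n} - {{}}"
  let ?G = "edge_product \<zeta> (pairs n)"
  note [measurable] = edge_product_measurable outlier_region_in_sets
  \<comment> \<open>An inhabited outlier region satisfies |A| r^2/8 \<le> L, since each outlier
    alone has 1 - cos at least r^2/8. With 16 L \<le> n r^2 this yields the condition 2|A| \<le> n
    of the pulling estimate.\<close>
  have outlier: "mass (outlier_region n r L A) \<le> ennreal (\<rho> ^ card A) * mass (box_region n r)"
    if A: "A \<in> ?P" for A
  proof (cases "outlier_region n r L A = {}")
    case False
    then obtain t where t: "t \<in> cube n" "\<And>j. j \<in> {1..n} \<Longrightarrow> r < \<bar>t j\<bar> \<longleftrightarrow> j \<in> A"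
      "(\<Sum>j\<in>{1..n}. 1 - cos (t j)) \<le> L"
      by (auto simp: outlier_region_def)
    have "real (card A) * (r\<^sup>2 / 8) \<le> (\<Sum>j\<in>A. 1 - cos (t j))"
    proof -
      have "r\<^sup>2 / 8 \<le> 1 - cos (t j)" if "j \<in> A" for j
      proof -
        have "j \<in> {1..n}" using that A by blast
        then have "r < \<bar>t j\<bar>" "t j \<in> {-pi..pi}" using t(2)[of j] t(1) that unfolding cube_def by blast+
        then have "r \<le> \<bar>t j\<bar>" "\<bar>t j\<bar> \<le> pi" by auto
        moreover from this have "r\<^sup>2 \<le> \<bar>t j\<bar>\<^sup>2" using r by (intro power_mono) auto
        ultimately show ?thesis using one_minus_cos_ge_square[of "t j"] by simp
      qed
      then show ?thesis using sum_mono[of A "\<lambda>_. r\<^sup>2 / 8" "\<lambda>j. 1 - cos (t j)"] by simp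
    qed
    also have "\<dots> \<le> (\<Sum>j\<in>{1..n}. 1 - cos (t j))" using A by (intro sum_mono2) auto
    finally have "2 * real (card A) * r\<^sup>2 \<le> real n * r\<^sup>2" using t(3) L by simp
    then have "2 * real (card A) \<le> real n" using r by simp
    then show ?thesis using A r s \<rho> by (intro nn_integral_outlier_region_le) auto
  qed simp
  have "mass (cluster_region n 1 L - box_region n r)
      \<le> (\<integral>\<^sup>+t. (\<Sum>A\<in>?P. ennreal (?G t) * indicator (outlier_region n r L A) t) \<partial>lebesgue_space n)"
  proof (rule nn_integral_mono)
    fix t
    show "ennreal (?G t) * indicator (cluster_region n 1 L - box_region n r) t
        \<le> (\<Sum>A\<in>?P. ennreal (?G t) * indicator (outlier_region n r L A) t)"
    proof (cases "t \<in> cluster_region n 1 L - box_region n r")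
      case True
      define A where "A = {j \<in> {1..n}. r < \<bar>t j\<bar>}"
      have t: "t \<in> cube n" "(\<Sum>j\<in>{1..n}. 1 - cos (t j)) \<le> L" "t \<notin> box_region n r"
        using True by (auto simp: cluster_region_def)
      have "A \<noteq> {}"
      proof
        assume "A = {}"
        then have "\<forall>j\<in>{1..n}. \<bar>t j\<bar> \<le> r" by (auto simp: A_def not_less)
        moreover have "t \<in> {1..n} \<rightarrow>\<^sub>E UNIV" using t(1) by (auto simp: cube_def)
        ultimately show False using t(3) by (simp add: box_region_def)
      qed
      then have A: "A \<in> ?P" by (auto simp: A_def)
      have "t \<in> outlier_region n r L A" using t by (auto simp: outlier_region_def A_def)
      then have "ennreal (?G t) * indicator (cluster_region n 1 L - box_region n r) t
          = ennreal (?G t) * indicator (outlier_region n r L A) t" using True by simp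
      also have "\<dots> \<le> (\<Sum>A\<in>?P. ennreal (?G t) * indicator (outlier_region n r L A) t)"
        using A by (intro member_le_sum) auto
      finally show ?thesis .
    qed simp
  qed
  also have "\<dots> = (\<Sum>A\<in>?P. mass (outlier_region n r L A))"
    by (intro nn_integral_sum) measurable
  also have "\<dots> \<le> (\<Sum>A\<in>?P. ennreal (\<rho> ^ card A) * mass (box_region n r))"
    by (intro sum_mono outlier)
  also have "\<dots> = (\<Sum>A\<in>?P. ennreal (\<rho> ^ card A)) * mass (box_region n r)"
    by (rule sum_distrib_right[symmetric])
  also have "(\<Sum>A\<in>?P. ennreal (\<rho> ^ card A)) = ennreal (\<Sum>A\<in>?P. \<rho> ^ card A)"
    using \<open>0 \<le> \<rho>\<close> by (intro sum_ennreal) simp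
  also have "(\<Sum>A\<in>?P. \<rho> ^ card A) = (1 + \<rho>) ^ n - 1"
    by (subst sum_Pow_power_card) simp_all
  finally show ?thesis .
qed

text \<open>The half turns preserve the measure and, on the cube, the integrand; they carry the
  cluster at \<plusminus>\<pi> outside \<open>W_region n\<close> into the cluster at the origin
  outside the box.\<close>

lemma mass_cluster_pi_le:
  assumes "r = ln (real n) / sqrt (real n)"
  shows "mass (cluster_region n (-1) L - W_region n) \<le> mass (cluster_region n 1 L - box_region n r)"
proof -
  let ?G = "edge_product \<zeta> (pairs n)"
  let ?N = "cluster_region n 1 L - box_region n r"
  have [measurable]: "(\<lambda>t. ennreal (?G t) * indicator ?N t) \<in> borel_measurable (lebesgue_space n)"
    using edge_product_measurable cluster_region_in_sets box_region_in_sets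
    by (intro borel_measurable_times_ennreal borel_measurable_indicator sets.Diff) auto
  have "mass (cluster_region n (-1) L - W_region n)
      \<le> (\<integral>\<^sup>+t. ennreal (?G (half_turns n t)) * indicator ?N (half_turns n t) \<partial>lebesgue_space n)"
  proof (rule nn_integral_mono)
    fix t
    show "ennreal (?G t) * indicator (cluster_region n (-1) L - W_region n) t
        \<le> ennreal (?G (half_turns n t)) * indicator ?N (half_turns n t)"
    proof (cases "t \<in> cluster_region n (-1) L - W_region n")
      case True
      then have "t \<in> cube n" by (auto simp: cluster_region_def)
      then have "half_turns n t \<notin> box_region n r" using True half_turns_box_region assms by blast
      then have "half_turns n t \<in> ?N" using True half_turns_cluster_region by blast
      then show ?thesis using True \<open>t \<in> cube n\<close> by (simp add: edge_product_half_turns)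
    qed simp
  qed
  also have "\<dots> = (\<integral>\<^sup>+t. ennreal (?G t) * indicator ?N t \<partial>distr (lebesgue_space n) (lebesgue_space n) (half_turns n))"
    by (intro nn_integral_distr[symmetric] measurable_half_turns) measurable
  finally show ?thesis by (simp only: distr_half_turns)
qed

lemma mass_defect_region_le:
  "mass (defect_region n T) \<le> ennreal (exp (- (\<delta> / 2 * T)) * (2 * pi) ^ n)"
proof -
  have "mass (defect_region n T) \<le> (\<integral>\<^sup>+t. ennreal (exp (- (\<delta> / 2 * T))) * indicator (cube n) t \<partial>lebesgue_space n)"
  proof (rule nn_integral_mono)
    fix t
    show "ennreal (edge_product \<zeta> (pairs n) t) * indicator (defect_region n T) t
        \<le> ennreal (exp (- (\<delta> / 2 * T))) * indicator (cube n) t"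
    proof (cases "t \<in> defect_region n T")
      case True
      then have t: "t \<in> cube n" "T < (\<Sum>e\<in>pairs n. defect t e)" by (auto simp: defect_region_def)
      have "edge_product \<zeta> (pairs n) t \<le> exp (- (\<delta> / 2 * (\<Sum>e\<in>pairs n. defect t e)))"
        by (rule edge_product_le) simp
      also have "\<dots> \<le> exp (- (\<delta> / 2 * T))" using t \<delta>_pos by simp
      finally show ?thesis using True t by (simp add: ennreal_leI)
    qed simp
  qed
  also have "\<dots> = ennreal (exp (- (\<delta> / 2 * T))) * emeasure (lebesgue_space n) (cube n)"
    using cube_in_sets by (rule nn_integral_cmult_indicator)
  also have "\<dots> = ennreal (exp (- (\<delta> / 2 * T)) * (2 * pi) ^ n)"
    using emeasure_PiM_lborel_box[of "{1..n}" "-pi" pi]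
    by (simp add: lebesgue_space_def cube_def ennreal_mult)
  finally show ?thesis .
qed

text \<open>On the smaller box of radius \<open>s\<close> the integrand is at least exp(-n), by the
  central lower bound with \<open>A\<close> the set of all coordinates and \<open>L\<close> equal to
  0.\<close>

lemma mass_box_region_ge:
  assumes r: "0 < s" "s \<le> r" "4 * r \<le> pi" and s: "real n * s\<^sup>2 \<le> 1"
  shows "ennreal (exp (- real n) * (2 * s) ^ n) \<le> mass (box_region n r)"
proof -
  have "ennreal (exp (- real n) * (2 * s) ^ n) = ennreal (exp (- real n)) * emeasure (lebesgue_space n) (box_region n s)"
    using emeasure_PiM_lborel_box[of "{1..n}" "-s" s] r
    by (simp add: lebesgue_space_def box_region_eq ennreal_mult)
  also have "\<dots> = (\<integral>\<^sup>+t. ennreal (exp (- real n)) * indicator (box_region n s) t \<partial>lebesgue_space n)"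
    using box_region_in_sets by (rule nn_integral_cmult_indicator[symmetric])
  also have "\<dots> \<le> mass (box_region n r)"
  proof (rule nn_integral_mono)
    fix t
    show "ennreal (exp (- real n)) * indicator (box_region n s) t
        \<le> ennreal (edge_product \<zeta> (pairs n) t) * indicator (box_region n r) t"
    proof (cases "t \<in> box_region n s")
      case True
      then have small: "\<bar>t j\<bar> \<le> s" if "j \<in> {1..n}" for j using that by (simp add: box_region_def)
      then have "\<bar>t j\<bar> \<le> r" if "j \<in> {1..n}" for j using r(2) that by force
      moreover from this have "t \<in> box_region n r" using True by (simp add: box_region_def)
      moreover have "edge_product \<zeta> {e \<in> pairs n. e \<subseteq> {1..n} - {1..n}} t = 1"
        unfolding edge_product_def by (rule prod.neutral) (auto simp: pairs_def)
      ultimately have "exp (- real n) \<le> edge_product \<zeta> (pairs n) t"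
        using edge_product_ge_central[of "{1..n}" t s r 0] small s r(3) by simp
      then show ?thesis using True \<open>t \<in> box_region n r\<close> by (simp add: ennreal_leI)
    qed simp
  qed
  finally show ?thesis .
qed

lemma mass_box_region_finite:
  assumes "0 \<le> r"
  shows "mass (box_region n r) < \<infinity>"
proof -
  have "mass (box_region n r) \<le> (\<integral>\<^sup>+t. 1 * indicator (box_region n r) t \<partial>lebesgue_space n)"
  proof (intro nn_integral_mono mult_right_mono)
    fix t
    have "edge_product \<zeta> (pairs n) t \<le> exp (- (\<delta> / 2 * (\<Sum>e\<in>pairs n. defect t e)))"
      by (rule edge_product_le) simp
    also have "\<dots> \<le> 1" using \<delta>_pos by (simp add: sum_nonneg)
    finally show "ennreal (edge_product \<zeta> (pairs n) t) \<le> 1" by simp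
  qed simp
  also have "\<dots> = emeasure (lebesgue_space n) (box_region n r)"
    using box_region_in_sets by simp
  also have "\<dots> < \<infinity>"
    using emeasure_PiM_lborel_box[of "{1..n}" "-r" r] assms
    by (simp add: lebesgue_space_def box_region_eq)
  finally show ?thesis .
qed

text \<open>The cube splits as in \<open>cube_cover\<close>. Each of the two clusters contributes
  \<open>(1 + \<rho>) ^ n - 1\<close>, and the region of large defect contributes \<open>q\<close>
  by comparing the volume of the cube with the lower bound for the box.\<close>

lemma mass_complement_le:
  fixes r s l \<rho> q :: real
  assumes n: "0 < n" and r_def: "r = ln (real n) / sqrt (real n)"
    and r: "0 < s" "s \<le> r" "4 * r \<le> pi" and s: "real n * s\<^sup>2 \<le> 1"
    and \<rho>: "pi * exp (1 + (2 * l + 2)) * exp (- (\<delta> / 2 * (real n * r\<^sup>2 / 32 - (2 * l + 2)))) \<le> \<rho> * s"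
    and L: "16 * (2 * l + 2) \<le> real n * r\<^sup>2" and "0 \<le> \<rho>" "0 \<le> q"
    and q: "exp (- (\<delta> / 2 * (real n * l))) * (2 * pi) ^ n \<le> q * (exp (- real n) * (2 * s) ^ n)"
  shows "mass (cube n - (U_region n \<union> W_region n)) \<le> ennreal (2 * ((1 + \<rho>) ^ n - 1) + q) * mass (U_region n)"
proof -
  let ?G = "edge_product \<zeta> (pairs n)"
  let ?D = "defect_region n (real n * l)"
  let ?C = "\<lambda>\<sigma>. cluster_region n \<sigma> (2 * l + 2)"
  have U: "U_region n = box_region n r" by (simp add: U_region_eq r_def)
  have "mass (cube n - (U_region n \<union> W_region n)) \<le>
    (\<integral>\<^sup>+t. ennreal (?G t) * indicator ?D t + ennreal (?G t) * indicator (?C 1 - box_region n r) t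
       + ennreal (?G t) * indicator (?C (-1) - W_region n) t \<partial>lebesgue_space n)"
  proof (rule nn_integral_mono)
    fix t
    show "ennreal (?G t) * indicator (cube n - (U_region n \<union> W_region n)) t \<le>
      ennreal (?G t) * indicator ?D t + ennreal (?G t) * indicator (?C 1 - box_region n r) t
       + ennreal (?G t) * indicator (?C (-1) - W_region n) t"
      using cube_cover[OF n, of l] by (auto simp: U indicator_def)
  qed
  also have "\<dots> = mass ?D + mass (?C 1 - box_region n r) + mass (?C (-1) - W_region n)"
  proof -
    note [measurable] = edge_product_measurable cluster_region_in_sets box_region_in_sets W_region_in_sets defect_region_in_sets
    show ?thesis by (simp add: nn_integral_add)
  qed
  also have "\<dots> \<le> ennreal q * mass (box_region n r) + ennreal ((1 + \<rho>) ^ n - 1) * mass (box_region n r)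
      + ennreal ((1 + \<rho>) ^ n - 1) * mass (box_region n r)"
  proof (intro add_mono)
    have "mass ?D \<le> ennreal (q * (exp (- real n) * (2 * s) ^ n))"
      using mass_defect_region_le q by (rule order_trans[OF _ ennreal_leI])
    also have "\<dots> = ennreal q * ennreal (exp (- real n) * (2 * s) ^ n)"
      using \<open>0 \<le> q\<close> r by (intro ennreal_mult) auto
    also have "\<dots> \<le> ennreal q * mass (box_region n r)"
      by (intro mult_left_mono mass_box_region_ge r s) simp
    finally show "mass ?D \<le> ennreal q * mass (box_region n r)" .
    show "mass (?C 1 - box_region n r) \<le> ennreal ((1 + \<rho>) ^ n - 1) * mass (box_region n r)"
      by (intro mass_cluster_origin_le[OF r s \<rho> L]) fact
    then show "mass (?C (-1) - W_region n) \<le> ennreal ((1 + \<rho>) ^ n - 1) * mass (box_region n r)"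
      by (rule order_trans[OF mass_cluster_pi_le[OF r_def]])
  qed
  also have "\<dots> = ennreal (2 * ((1 + \<rho>) ^ n - 1) + q) * mass (box_region n r)"
  proof -
    have "0 \<le> (1 + \<rho>) ^ n - 1" using \<open>0 \<le> \<rho>\<close> by (simp add: one_le_power)
    then have "ennreal (q + ((1 + \<rho>) ^ n - 1) + ((1 + \<rho>) ^ n - 1))
        = ennreal q + ennreal ((1 + \<rho>) ^ n - 1) + ennreal ((1 + \<rho>) ^ n - 1)"
      using \<open>0 \<le> q\<close> by (simp only: ennreal_plus add_nonneg_nonneg)
    moreover have "2 * ((1 + \<rho>) ^ n - 1) + q = q + ((1 + \<rho>) ^ n - 1) + ((1 + \<rho>) ^ n - 1)" by simp
    ultimately show ?thesis by (simp only: distrib_right)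
  qed
  finally show ?thesis unfolding U .
qed

end

section \<open>From masses to Lebesgue integrals\<close>

context edge_parameters begin

lemma set_integral_eq_mass:
  assumes "R \<in> sets (lebesgue_space n)"
  shows "(LINT t:R|lebesgue_space n. edge_product \<zeta> (pairs n) t) = enn2real (mass R)"
proof -
  have "(\<lambda>t. indicator R t * edge_product \<zeta> (pairs n) t) \<in> borel_measurable (lebesgue_space n)"
    using assms edge_product_measurable
    by (intro borel_measurable_times borel_measurable_indicator)
  then have "(LINT t:R|lebesgue_space n. edge_product \<zeta> (pairs n) t)
      = enn2real (\<integral>\<^sup>+t. ennreal (indicator R t * edge_product \<zeta> (pairs n) t) \<partial>lebesgue_space n)"
    unfolding set_lebesgue_integral_def real_scaleR_def
    by (intro integral_eq_nn_integral) (auto simp: edge_product_nonneg)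
  also have "(\<integral>\<^sup>+t. ennreal (indicator R t * edge_product \<zeta> (pairs n) t) \<partial>lebesgue_space n) = mass R"
    by (intro nn_integral_cong) (simp add: indicator_def)
  finally show ?thesis .
qed

text \<open>Passing to real numbers is monotone here because the mass of \<open>U_region n\<close>
  is finite: the integrand is at most 1 on a bounded box.\<close>

lemma set_integral_complement_le:
  assumes "mass (cube n - (U_region n \<union> W_region n)) \<le> ennreal p * mass (U_region n)"
    and "0 \<le> p" "p \<le> p'" and "1 \<le> n"
  shows "(LINT t:cube n - (U_region n \<union> W_region n)|lebesgue_space n. edge_product \<zeta> (pairs n) t)
    \<le> p' * (LINT t:U_region n|lebesgue_space n. edge_product \<zeta> (pairs n) t)"
proof -
  have U: "U_region n \<in> sets (lebesgue_space n)" unfolding U_region_eq by (rule box_region_in_sets)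
  have "0 \<le> ln (real n) / sqrt (real n)" using \<open>1 \<le> n\<close> by simp
  then have fin: "mass (U_region n) < \<infinity>" unfolding U_region_eq by (rule mass_box_region_finite)
  have "enn2real (mass (cube n - (U_region n \<union> W_region n))) \<le> enn2real (ennreal p * mass (U_region n))"
    using assms(1) fin by (intro enn2real_mono) (auto simp: ennreal_mult_less_top)
  also have "\<dots> = p * enn2real (mass (U_region n))" using \<open>0 \<le> p\<close> by (simp add: enn2real_mult)
  also have "\<dots> \<le> p' * enn2real (mass (U_region n))" using \<open>p \<le> p'\<close> by (intro mult_right_mono) auto
  finally show ?thesis
    by (simp add: set_integral_eq_mass U cube_in_sets W_region_in_sets sets.Diff sets.Un)
qed

end

section \<open>Choice of the constants and conclusion\<close>

theorem theorem8p1: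
  fixes \<delta> \<kappa> :: real
  assumes "0 < \<delta>" and "\<delta> \<le> 1 / 2" and "0 < \<kappa>"
  shows "\<exists>\<gamma>::real. \<gamma> > 0 \<and> (\<forall>(n::nat) (d :: nat \<Rightarrow> nat). real n > \<gamma> \<longrightarrow> tame \<delta> n d \<longrightarrow>
    (LINT t:cube n - (U_region n \<union> W_region n)|lebesgue_space n. cmod (F n d t))
      \<le> real n powr (- \<kappa>) * (LINT t:U_region n|lebesgue_space n. cmod (F n d t)))"
proof -
  \<comment> \<open>With defect threshold n l and l = C ln n, the exponent \<delta>/2 * n l becomes
    (\<kappa> + 3) n ln n. This outweighs the factor n^(n/2) lost to a box of side 2 / sqrt n, as
    well as n^\<kappa> and exponentials in n.\<close>
  define C where "C = 2 * (\<kappa> + 3) / \<delta>"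
  \<comment> \<open>In order: \<rho> = n^(-\<kappa> - 2) makes (1 + \<rho>)^n - 1 of order
    n^(-\<kappa> - 1); the gain exp(-\<delta> (ln n)^2 / 64) per outlier beats every power of n; the
    logarithm of the condition on \<open>q\<close>, with 2^n cancelled; L = O(ln n) against n r^2 =
    (ln n)^2; r tends to 0; and \<open>s \<le> r\<close>.\<close>
  have "\<forall>\<^sub>F n :: nat in sequentially. 3 \<le> n
    \<and> 2 * ((1 + real n powr (- (\<kappa> + 2))) ^ n - 1) \<le> real n powr (-\<kappa>) / 2
    \<and> pi * exp (1 + (2 * (C * ln (real n)) + 2)) *
        exp (- (\<delta> / 2 * ((ln (real n))\<^sup>2 / 32 - (2 * (C * ln (real n)) + 2))))
        \<le> real n powr (- (\<kappa> + 2)) * (1 / sqrt (real n))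
    \<and> real n * ln pi - (\<kappa> + 3) * (real n * ln (real n))
        \<le> - \<kappa> * ln (real n) - ln 2 - real n - real n * (ln (real n) / 2)
    \<and> 16 * (2 * (C * ln (real n)) + 2) \<le> (ln (real n))\<^sup>2
    \<and> 4 * (ln (real n) / sqrt (real n)) \<le> pi \<and> 1 \<le> ln (real n)"
    using \<open>0 < \<kappa>\<close> \<open>0 < \<delta>\<close> by (intro eventually_conj) real_asymp+
  then obtain N where N: "\<And>n :: nat. N \<le> n \<Longrightarrow> 3 \<le> n
    \<and> 2 * ((1 + real n powr (- (\<kappa> + 2))) ^ n - 1) \<le> real n powr (-\<kappa>) / 2
    \<and> pi * exp (1 + (2 * (C * ln (real n)) + 2)) *
        exp (- (\<delta> / 2 * ((ln (real n))\<^sup>2 / 32 - (2 * (C * ln (real n)) + 2))))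
        \<le> real n powr (- (\<kappa> + 2)) * (1 / sqrt (real n))
    \<and> real n * ln pi - (\<kappa> + 3) * (real n * ln (real n))
        \<le> - \<kappa> * ln (real n) - ln 2 - real n - real n * (ln (real n) / 2)
    \<and> 16 * (2 * (C * ln (real n)) + 2) \<le> (ln (real n))\<^sup>2
    \<and> 4 * (ln (real n) / sqrt (real n)) \<le> pi \<and> 1 \<le> ln (real n)"
    unfolding eventually_sequentially by blast
  have "(LINT t:cube n - (U_region n \<union> W_region n)|lebesgue_space n. cmod (F n d t))
      \<le> real n powr (- \<kappa>) * (LINT t:U_region n|lebesgue_space n. cmod (F n d t))"
    if n: "real n > real (Suc N)" and tame: "tame \<delta> n d" for n d
  proof -
    have "N \<le> n" using n by simp
    note asymp = N[OF this]
    define \<zeta> where "\<zeta> = max_entropy_matrix n d"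
    interpret edge_parameters n \<zeta> \<delta>
      using tame \<open>0 < \<delta>\<close> by unfold_locales (auto simp: tame_def \<zeta>_def)
    \<comment> \<open>The largest \<open>s\<close> with n s^2 \<le> 1. The target n^(-\<kappa>) is
      split evenly: \<open>q\<close> takes one half and the two clusters together the other.\<close>
    define s where "s = 1 / sqrt (real n)"
    define r where "r = ln (real n) / sqrt (real n)"
    define l where "l = C * ln (real n)"
    define \<rho> where "\<rho> = real n powr (- (\<kappa> + 2))"
    define q where "q = real n powr (-\<kappa>) / 2"
    have n_pos: "0 < n" using asymp by simp
    have s: "0 < s" "real n * s\<^sup>2 \<le> 1" using n_pos by (simp_all add: s_def power_divide)
    have r: "s \<le> r" "real n * r\<^sup>2 = (ln (real n))\<^sup>2"
      using n_pos asymp by (simp_all add: s_def r_def power_divide divide_right_mono)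
    have "exp (- (\<delta> / 2 * (real n * l))) * (2 * pi) ^ n \<le> q * (exp (- real n) * (2 * s) ^ n)"
    proof -
      have s_eq: "s = exp (- (ln (real n) / 2))"
        using n_pos by (simp add: s_def exp_minus inverse_eq_divide flip: ln_sqrt)
      have pi_eq: "pi ^ n = exp (real n * ln pi)" by (simp add: exp_of_nat_mult)
      have q_eq: "q = exp (- \<kappa> * ln (real n) - ln 2)"
        using n_pos by (simp add: q_def powr_def exp_diff)
      have "\<delta> / 2 * (real n * l) = (\<kappa> + 3) * (real n * ln (real n))"
        using \<open>0 < \<delta>\<close> by (simp add: l_def C_def)
      then have "exp (- (\<delta> / 2 * (real n * l))) * (2 * pi) ^ n
          = 2 ^ n * exp (real n * ln pi - (\<kappa> + 3) * (real n * ln (real n)))"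
        by (simp add: power_mult_distrib pi_eq exp_diff exp_minus field_simps)
      also have "\<dots> \<le> 2 ^ n * exp (- \<kappa> * ln (real n) - ln 2 - real n - real n * (ln (real n) / 2))"
        using asymp by simp
      also have "exp (- \<kappa> * ln (real n) - ln 2 - real n - real n * (ln (real n) / 2)) = q * exp (- real n) * s ^ n"
        unfolding q_eq s_eq exp_of_nat_mult[symmetric] by (simp flip: exp_add)
      finally show ?thesis by (simp add: power_mult_distrib mult_ac)
    qed
    then have bound: "mass (cube n - (U_region n \<union> W_region n))
        \<le> ennreal (2 * ((1 + \<rho>) ^ n - 1) + q) * mass (U_region n)"
    proof (rule mass_complement_le[rotated -1, where r = r and s = s and l = l])
      show "4 * r \<le> pi" using asymp by (simp add: r_def)
      show "pi * exp (1 + (2 * l + 2)) * exp (- (\<delta> / 2 * (real n * r\<^sup>2 / 32 - (2 * l + 2)))) \<le> \<rho> * s"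
        unfolding r(2) l_def \<rho>_def s_def using asymp by blast
      show "16 * (2 * l + 2) \<le> real n * r\<^sup>2"
        unfolding r(2) l_def using asymp by blast
    qed (use n_pos s r in \<open>simp_all add: r_def \<rho>_def q_def\<close>)
    show ?thesis
      unfolding cmod_F \<zeta>_def[symmetric]
    proof (rule set_integral_complement_le[OF bound])
      show "0 \<le> 2 * ((1 + \<rho>) ^ n - 1) + q" by (simp add: \<rho>_def q_def one_le_power)
      show "2 * ((1 + \<rho>) ^ n - 1) + q \<le> real n powr (- \<kappa>)"
        using asymp unfolding \<rho>_def q_def by linarith
    qed (use n_pos in simp)
  qed
  \<comment> \<open>The successor keeps the constant positive even when \<open>N\<close> is
    0.\<close>
  then show ?thesis by (intro exI[of _ "real (Suc N)"]) auto
qed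

end
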